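(* Let $\mu$ be a positive Radon measure on $\mathbb{R}^d$ satisfying the growth condition with constants $C_0>0$, $n\in(0,d]$, let $1 \le q \le p<\infty$ and $r\in(1,\infty)$, and let $\{f_j\}_{j \in \mathbb{N}}$ be a sequence of functions each belonging to $\mathcal{C}^p_q(\mu)$. Assume that there exists an increasing sequence of concentric doubling cubes $I_0 \subset I_1 \subset \cdots \subset I_k \subset \cdots$ in $\mathcal{Q}(\mu,2)$ such that $\lim_{k \to \infty}m_{I_k}(f_j)=0$ for all $j$ and $\bigcup_k I_k=\mathbb{R}^d$. Then \[ C^{-1}\,\|f_j \, : \, \mathcal{C}^p_q(l^r,\mu)\| \le \|f_j \, : \, \mathcal{M}^p_q(l^r,\mu)\| \le C\,\|f_j \, : \, \mathcal{C}^p_q(l^r,\mu)\| \] for a constant $C>0$ independent of $\{f_j\}_{j \in \mathbb{N}}$.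
   Context: Growth condition: $\mu(Q(x,l)) \le C_0\,l^n$ for all $x \in \operatorname{supp}(\mu)$ and $l>0$. Cubes are closed with sides parallel to the axes; $Q(x,l)$ is the cube centered at $x$ of side length $l$; $z_Q$, $\ell(Q)$ are center and side length; $\rho Q$ is concentric with $Q$ of side length $\rho\ell(Q)$. $\mathcal{Q}(\mu)$ is the set of cubes of positive $\mu$-measure (including $\mathbb{R}^d$ if $\mu$ is finite). $Q\in\mathcal{Q}(\mu)$ is doubling if $\mu(2Q)\le 2^{d+1}\mu(Q)$; $\mathcal{Q}(\mu,2)$ is the set of doubling cubes. For $Q\in\mathcal{Q}(\mu)$, $Q^*$ is the smallest doubling cube of the form $2^jQ$, $j\ge 0$. For $Q\subset R$, $Q\in\mathcal{Q}(\mu)$, let $Q_R$ be the smallest cube concentric with $Q$ containing $R$, $\delta(Q,R):=\int_{\ell(Q)}^{\ell(Q_R)} \mu(Q(z_Q,l))\,l^{-n}\,\frac{dl}{l}$ and $K_{Q,R}:=1+\delta(Q,R)$. $m_Q(f):=\mu(Q)^{-1}\int_Q f\,d\mu$. $\|a_j:l^r\|$ denotes the $l^r$-norm of the sequence $\{a_j\}_j$. The scalar space $\mathcal{C}^p_q(\mu)$ is the set of $f\in L^1_{loc}(\mu)$ with \[ \sup_{Q \in \mathcal{Q}(\mu)} \mu(2Q)^{\frac{1}{p}-\frac{1}{q}} \Big(\int_Q|f-m_{Q^*}(f)|^q\,d\mu\Big)^{\frac{1}{q}} + \sup_{Q \subset R,\ Q,R \in \mathcal{Q}(\mu,2)} \mu(Q)^{\frac{1}{p}}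 \frac{|m_Q(f)-m_R(f)|}{K_{Q,R}}<\infty. \] Vector-valued norms: \[ \|f_j : \mathcal{C}^p_q(l^r,\mu)\| := \sup_{Q \in \mathcal{Q}(\mu)} \mu(2Q)^{\frac{1}{p}-\frac{1}{q}} \Big(\int_Q \|f_j(x)-m_{Q^*}(f_j) : l^r\|^q\,d\mu(x)\Big)^{\frac{1}{q}} + \sup_{Q \subset R,\ Q,R \in \mathcal{Q}(\mu,2)} \mu(Q)^{\frac{1}{p}} \frac{\|m_Q(f_j)-m_R(f_j) : l^r\|}{K_{Q,R}}, \] \[ \|f_j : \mathcal{M}^p_q(l^r,\mu)\| := \sup_{Q \in \mathcal{Q}(\mu)} \mu(2Q)^{\frac{1}{p}-\frac{1}{q}} \Big(\int_Q\|f_j : l^r\|^q\,d\mu\Big)^{\frac{1}{q}}. \] *)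

theory Defs
  imports "HOL-Analysis.Analysis"
begin

text \<open>A cube is represented by a pair (centre, side length) with side length in ereal;
  side length \<infinity> encodes the whole space R^d (which is a "cube" of Q(mu) when mu is finite).\<close>

type_synonym 'd cube = "(real^'d) \<times> ereal"

definition cube_set :: "'d::finite cube \<Rightarrow> (real^'d) set" where
  "cube_set Q = (if snd Q = \<infinity> then UNIV
      else {y. \<forall>i. \<bar>y$i - fst Q $ i\<bar> \<le> real_of_ereal (snd Q) / 2})"

definition Qc :: "real^'d \<Rightarrow> real \<Rightarrow> 'd::finite cube" where
  "Qc x l = (x, ereal l)"

definition dil :: "real \<Rightarrow> 'd::finite cube \<Rightarrow> 'd cube" where
  "dil \<rho> Q = (fst Q, ereal \<rho> * snd Q)"

definition radon :: "(real^'d::finite) measure \<Rightarrow> bool" where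
  "radon M \<longleftrightarrow> sets M = sets borel \<and> (\<forall>K. compact K \<longrightarrow> emeasure M K < \<infinity>)"

definition msupp :: "(real^'d::finite) measure \<Rightarrow> (real^'d) set" where
  "msupp M = {x. \<forall>e>0. 0 < emeasure M (ball x e)}"

definition growth :: "(real^'d::finite) measure \<Rightarrow> real \<Rightarrow> real \<Rightarrow> bool" where
  "growth M C0 n \<longleftrightarrow> (\<forall>x\<in>msupp M. \<forall>l>0. emeasure M (cube_set (Qc x l)) \<le> ennreal (C0 * l powr n))"

definition Qmu :: "(real^'d::finite) measure \<Rightarrow> 'd cube set" where
  "Qmu M = {Q. 0 < snd Q \<and> (snd Q = \<infinity> \<longrightarrow> emeasure M UNIV < \<infinity>)
              \<and> 0 < emeasure M (cube_set Q)}"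

definition doubling :: "(real^'d::finite) measure \<Rightarrow> 'd cube \<Rightarrow> bool" where
  "doubling M Q \<longleftrightarrow> Q \<in> Qmu M \<and>
     emeasure M (cube_set (dil 2 Q)) \<le> 2 ^ (CARD('d) + 1) * emeasure M (cube_set Q)"

definition dstar :: "(real^'d::finite) measure \<Rightarrow> 'd cube \<Rightarrow> 'd cube" where
  "dstar M Q = dil (2 ^ (LEAST j::nat. doubling M (dil (2 ^ j) Q))) Q"

definition mean :: "(real^'d::finite) measure \<Rightarrow> 'd cube \<Rightarrow> (real^'d \<Rightarrow> real) \<Rightarrow> real" where
  "mean M Q f = (\<integral>x\<in>cube_set Q. f x \<partial>M) / measure M (cube_set Q)"

definition side_QR :: "'d::finite cube \<Rightarrow> 'd cube \<Rightarrow> ereal" where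
  "side_QR Q R = Inf {l. 0 < l \<and> cube_set R \<subseteq> cube_set (fst Q, l)}"

definition delta :: "(real^'d::finite) measure \<Rightarrow> real \<Rightarrow> 'd cube \<Rightarrow> 'd cube \<Rightarrow> ennreal" where
  "delta M n Q R = (\<integral>\<^sup>+ l. indicator {l. snd Q \<le> ereal l \<and> ereal l \<le> side_QR Q R} l
        * emeasure M (cube_set (Qc (fst Q) l)) * ennreal (l powr (- n) / l) \<partial>lborel)"

definition Kqr :: "(real^'d::finite) measure \<Rightarrow> real \<Rightarrow> 'd cube \<Rightarrow> 'd cube \<Rightarrow> ennreal" where
  "Kqr M n Q R = 1 + delta M n Q R"

text \<open>Real power of an extended nonnegative real (for positive exponents).\<close>
definition epowr :: "ennreal \<Rightarrow> real \<Rightarrow> ennreal" where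
  "epowr x a = (if x = \<infinity> then \<infinity> else ennreal (enn2real x powr a))"

definition lr_norm :: "real \<Rightarrow> (nat \<Rightarrow> real) \<Rightarrow> ennreal" where
  "lr_norm r a = (if summable (\<lambda>j. \<bar>a j\<bar> powr r)
                  then ennreal ((\<Sum>j. \<bar>a j\<bar> powr r) powr (1 / r)) else \<infinity>)"

definition loc_integrable :: "(real^'d::finite) measure \<Rightarrow> (real^'d \<Rightarrow> real) \<Rightarrow> bool" where
  "loc_integrable M f \<longleftrightarrow> (\<forall>K. compact K \<longrightarrow> set_integrable M K f)"

definition Cpq_norm :: "(real^'d::finite) measure \<Rightarrow> real \<Rightarrow> real \<Rightarrow> real \<Rightarrow> (real^'d \<Rightarrow> real) \<Rightarrow> ennreal" where
  "Cpq_norm M n p q f =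
     (SUP Q\<in>Qmu M. ennreal (measure M (cube_set (dil 2 Q)) powr (1/p - 1/q)) *
         epowr (\<integral>\<^sup>+x\<in>cube_set Q. epowr (ennreal \<bar>f x - mean M (dstar M Q) f\<bar>) q \<partial>M) (1/q))
   + (SUP QR\<in>{(Q,R). doubling M Q \<and> doubling M R \<and> cube_set Q \<subseteq> cube_set R}.
         ennreal (measure M (cube_set (fst QR)) powr (1/p)) *
         ennreal \<bar>mean M (fst QR) f - mean M (snd QR) f\<bar> / Kqr M n (fst QR) (snd QR))"

text \<open>The space C^p_q(mu); we require f in L^1_loc and integrable on every Q in Q(mu)
  (so that all the averages m_Q(f) are defined).\<close>
definition Cpq :: "(real^'d::finite) measure \<Rightarrow> real \<Rightarrow> real \<Rightarrow> real \<Rightarrow> (real^'d \<Rightarrow> real) set" where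
  "Cpq M n p q = {f. loc_integrable M f \<and> (\<forall>Q\<in>Qmu M. set_integrable M (cube_set Q) f)
                    \<and> Cpq_norm M n p q f < \<infinity>}"

definition Cpq_lr_norm :: "(real^'d::finite) measure \<Rightarrow> real \<Rightarrow> real \<Rightarrow> real \<Rightarrow> real
      \<Rightarrow> (nat \<Rightarrow> real^'d \<Rightarrow> real) \<Rightarrow> ennreal" where
  "Cpq_lr_norm M n p q r f =
     (SUP Q\<in>Qmu M. ennreal (measure M (cube_set (dil 2 Q)) powr (1/p - 1/q)) *
         epowr (\<integral>\<^sup>+x\<in>cube_set Q.
            epowr (lr_norm r (\<lambda>j. f j x - mean M (dstar M Q) (f j))) q \<partial>M) (1/q))
   + (SUP QR\<in>{(Q,R). doubling M Q \<and> doubling M R \<and> cube_set Q \<subseteq> cube_set R}.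
         ennreal (measure M (cube_set (fst QR)) powr (1/p)) *
         lr_norm r (\<lambda>j. mean M (fst QR) (f j) - mean M (snd QR) (f j)) / Kqr M n (fst QR) (snd QR))"

definition Mpq_lr_norm :: "(real^'d::finite) measure \<Rightarrow> real \<Rightarrow> real \<Rightarrow> real
      \<Rightarrow> (nat \<Rightarrow> real^'d \<Rightarrow> real) \<Rightarrow> ennreal" where
  "Mpq_lr_norm M p q r f =
     (SUP Q\<in>Qmu M. ennreal (measure M (cube_set (dil 2 Q)) powr (1/p - 1/q)) *
         epowr (\<integral>\<^sup>+x\<in>cube_set Q. epowr (lr_norm r (\<lambda>j. f j x)) q \<partial>M) (1/q))"

end

theory Submission
  imports Defs
begin

text \<open>Both estimates reduce to bounding \<open>\<parallel>m_Q(f_j) : l^r\<parallel>\<close> by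
  \<open>\<mu>(Q) powr (- 1 / p)\<close> times the norm, for doubling \<open>Q\<close>.
  For the Morrey norm this is Minkowski's and Hoelder's inequality. For the Campanato norm, attach to
  \<open>Q\<close> a chain of concentric doubling cubes \<open>Q = Q_0 \<subset> Q_1 \<subset> \<dots>\<close> whose measures grow at least
  geometrically while the coefficients \<open>K_{Q_i,Q_{i+1}}\<close> stay bounded; the telescoping sum of
  \<open>m_{Q_i}(f_j) - m_{Q_{i+1}}(f_j)\<close> is then dominated by a geometric series. The chain is stopped when it leaves
  \<open>I_k\<close>, the last cube is compared with \<open>I_k\<close>, and \<open>k\<close> tends to infinity.
  As constants are irrelevant, all triangle, Hoelder and Minkowski inequalities are proved only up to
  numerical factors.\<close>

section \<open>Powers and sequence norms\<close>

text \<open>Comparing \<open>Q\<close> with \<open>I_k\<close> in a single step costs the factor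
  \<open>K_{Q,I_k}\<close>, which may tend to infinity with \<open>k\<close>. The negative power
  \<open>- 1 / p\<close> of the measure repairs this: the loss is spread over cubes of growing
  measure, each link having a bounded coefficient and a much smaller weight than the one before.
  Such cubes exist because the doubling constant \<open>2 ^ (d + 1)\<close> is at least
  \<open>2 * 2 powr n\<close>. While dilates by 2 fail to be doubling, the measure outruns
  \<open>l powr n\<close> geometrically; this cannot go on for ever, and until it ends these scales
  contribute only a geometric series to the coefficient. If instead the measure stays bounded on the
  dilates, the integral defining \<open>delta\<close> converges and one link reaches every larger
  cube. A further obstacle is that \<open>Q\<close> and \<open>I_k\<close> may have different
  centres while \<open>delta\<close> uses cubes concentric with \<open>Q\<close>. For large
  \<open>k\<close>, a chain cube that sticks out of \<open>I_k\<close> has a dilate by 4 containing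
  \<open>I_k\<close>, and the bound for the coefficient leaves room for this factor.\<close>

lemma epowr_mono: "0 \<le> a \<Longrightarrow> x \<le> y \<Longrightarrow> epowr x a \<le> epowr y a"
  by (cases x; cases y) (auto simp: epowr_def top_unique intro!: ennreal_leI powr_mono2)

lemma epowr_ennreal: "0 \<le> x \<Longrightarrow> epowr (ennreal x) a = ennreal (x powr a)"
  by (simp add: epowr_def)

lemma epowr_top [simp]: "epowr top a = top"
  by (simp add: epowr_def)

lemma epowr_epowr: "a > 0 \<Longrightarrow> epowr (epowr x a) b = epowr x (a * b)"
  by (cases x) (auto simp: epowr_ennreal powr_powr)

lemma epowr_one: "epowr x 1 = x"
  by (cases x) (auto simp: epowr_ennreal)

lemma epowr_cmult:
  assumes "0 < c" shows "epowr (ennreal c * x) a = ennreal (c powr a) * epowr x a"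
proof (cases x)
  case (real y)
  then show ?thesis using assms
    by (auto simp: epowr_ennreal powr_mult simp flip: ennreal_mult)
qed (use assms in \<open>auto simp: ennreal_mult_top\<close>)

text \<open>\<open>x + y\<close> is at most twice the maximum. In contrast to convexity this covers
  every exponent \<open>a \<ge> 0\<close>, so one lemma serves \<open>q\<close>, \<open>r\<close>
  and their reciprocals.\<close>

lemma epowr_add_le:
  assumes "0 \<le> a" shows "epowr (x + y) a \<le> ennreal (2 powr a) * (epowr x a + epowr y a)"
proof -
  have "x + y \<le> ennreal 2 * max x y"
    by (metis add_mono max.cobounded1 max.cobounded2 mult_2 ennreal_numeral zero_le_numeral)
  then have "epowr (x + y) a \<le> epowr (ennreal 2 * max x y) a"
    by (rule epowr_mono[OF assms])
  also have "\<dots> = ennreal (2 powr a) * epowr (max x y) a"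
    by (rule epowr_cmult) simp
  also have "\<dots> \<le> ennreal (2 powr a) * (epowr x a + epowr y a)"
    by (intro mult_left_mono) (auto simp: max_def)
  finally show ?thesis .
qed

lemma borel_measurable_epowr [measurable]:
  assumes [measurable]: "F \<in> borel_measurable M"
  shows "(\<lambda>x. epowr (F x) a) \<in> borel_measurable M"
  unfolding epowr_def by measurable

text \<open>As a series in \<open>ennreal\<close> the norm needs no summability test, since
  divergence simply yields \<open>\<infinity>\<close>. Measurability and the quasi-triangle
  inequality rest on this form.\<close>

lemma lr_norm_eq:
  assumes "r > 0"
  shows "lr_norm r a = epowr (\<Sum>j. ennreal (\<bar>a j\<bar> powr r)) (1 / r)"
proof (cases "summable (\<lambda>j. \<bar>a j\<bar> powr r)")
  case True
  then show ?thesis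
    by (simp add: lr_norm_def suminf_ennreal2 epowr_ennreal suminf_nonneg)
next
  case False
  then have "(\<Sum>j. ennreal (\<bar>a j\<bar> powr r)) = top"
    using summable_suminf_not_top[of "\<lambda>j. \<bar>a j\<bar> powr r"] by (metis powr_ge_zero)
  then show ?thesis using False by (simp add: lr_norm_def)
qed

lemma lr_norm_leI:
  assumes r: "r > 0"
    and le: "\<And>m. ennreal ((\<Sum>j<m. \<bar>a j\<bar> powr r) powr (1 / r)) \<le> B"
  shows "lr_norm r a \<le> B"
proof -
  have "(\<Sum>j. ennreal (\<bar>a j\<bar> powr r)) \<le> epowr B r"
  proof (rule suminf_le_const)
    fix m
    have nn: "0 \<le> (\<Sum>j<m. \<bar>a j\<bar> powr r)" by (simp add: sum_nonneg)
    have "(\<Sum>j<m. ennreal (\<bar>a j\<bar> powr r)) = epowr (ennreal ((\<Sum>j<m. \<bar>a j\<bar> powr r) powr (1 / r))) r"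
      using r nn by (simp add: epowr_ennreal powr_powr)
    also have "\<dots> \<le> epowr B r" using r le by (intro epowr_mono) auto
    finally show "(\<Sum>j<m. ennreal (\<bar>a j\<bar> powr r)) \<le> epowr B r" .
  qed simp
  then have "lr_norm r a \<le> epowr (epowr B r) (1 / r)"
    unfolding lr_norm_eq[OF r] using r by (intro epowr_mono) auto
  also have "\<dots> = B" using r by (simp add: epowr_epowr epowr_one)
  finally show ?thesis .
qed

lemma sum_powr_le_lr_norm:
  assumes r: "r > 0"
  shows "ennreal ((\<Sum>j<m. \<bar>a j\<bar> powr r) powr (1 / r)) \<le> lr_norm r a"
proof -
  have "(\<Sum>j<m. ennreal (\<bar>a j\<bar> powr r)) \<le> (\<Sum>j. ennreal (\<bar>a j\<bar> powr r))"
    by (rule sum_le_suminf) auto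
  then have "epowr (\<Sum>j<m. ennreal (\<bar>a j\<bar> powr r)) (1 / r) \<le> lr_norm r a"
    unfolding lr_norm_eq[OF r] using r by (intro epowr_mono) auto
  then show ?thesis by (simp add: epowr_ennreal sum_nonneg)
qed

lemma lr_norm_zero: "lr_norm r (\<lambda>j. 0) = 0"
  by (simp add: lr_norm_def)

lemma lr_norm_uminus: "lr_norm r (\<lambda>j. - a j) = lr_norm r a"
  by (simp add: lr_norm_def)

lemma lr_norm_add_le:
  assumes r: "r \<ge> 1"
  shows "lr_norm r (\<lambda>j. a j + b j) \<le> 4 * (lr_norm r a + lr_norm r b)"
proof -
  define S where "S = (\<lambda>a. (\<Sum>j. ennreal (\<bar>a j\<bar> powr r)))"
  have lr: "lr_norm r a = epowr (S a) (1 / r)" for a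
    using r by (simp add: lr_norm_eq S_def)
  have term_le: "ennreal (\<bar>x + y\<bar> powr r) \<le> ennreal (2 powr r) * (ennreal (\<bar>x\<bar> powr r) + ennreal (\<bar>y\<bar> powr r))"
    for x y :: real
  proof -
    have "ennreal (\<bar>x + y\<bar> powr r) \<le> ennreal ((\<bar>x\<bar> + \<bar>y\<bar>) powr r)"
      using r by (intro ennreal_leI powr_mono2) auto
    also have "\<dots> \<le> ennreal (2 powr r) * (ennreal (\<bar>x\<bar> powr r) + ennreal (\<bar>y\<bar> powr r))"
      using epowr_add_le[of r "ennreal \<bar>x\<bar>" "ennreal \<bar>y\<bar>"] r
      by (simp add: epowr_ennreal flip: ennreal_plus)
    finally show ?thesis .
  qed
  have "S (\<lambda>j. a j + b j) \<le> (\<Sum>j. ennreal (2 powr r) * (ennreal (\<bar>a j\<bar> powr r) + ennreal (\<bar>b j\<bar> powr r)))"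
    unfolding S_def by (intro suminf_le term_le) auto
  also have "\<dots> = ennreal (2 powr r) * (S a + S b)"
    by (simp add: S_def suminf_add)
  finally have "lr_norm r (\<lambda>j. a j + b j) \<le> epowr (ennreal (2 powr r) * (S a + S b)) (1 / r)"
    unfolding lr using r by (intro epowr_mono) auto
  also have "\<dots> = ennreal 2 * epowr (S a + S b) (1 / r)"
    using r by (subst epowr_cmult) (auto simp: powr_powr)
  also have "\<dots> \<le> ennreal 2 * (ennreal (2 powr (1 / r)) * (lr_norm r a + lr_norm r b))"
    unfolding lr using r by (intro mult_left_mono epowr_add_le) auto
  \<comment> \<open>One factor 2 comes from the power \<open>r\<close>, the other from
    \<open>2 powr (1 / r) \<le> 2\<close>.\<close>
  also have "\<dots> \<le> ennreal 2 * (ennreal 2 * (lr_norm r a + lr_norm r b))"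
    using r powr_mono[of "1 / r" 1 2] by (intro mult_left_mono mult_right_mono ennreal_leI) auto
  finally show ?thesis by (simp add: mult.assoc[symmetric] flip: ennreal_mult)
qed

lemma borel_measurable_lr_norm [measurable]:
  assumes r: "r > 0" and [measurable]: "\<And>j. g j \<in> borel_measurable M"
  shows "(\<lambda>x. lr_norm r (\<lambda>j. g j x)) \<in> borel_measurable M"
  unfolding lr_norm_eq[OF r] by measurable

text \<open>Fatou's lemma for sequences: a finite section depends continuously on its coordinates,
  so convergence in each coordinate suffices, with no uniformity in \<open>j\<close>.\<close>

lemma lr_norm_le_of_tendsto:
  assumes r: "r > 0" and lim: "\<And>j. (\<lambda>k. a k j) \<longlonglongrightarrow> b j"
    and le: "eventually (\<lambda>k. lr_norm r (a k) \<le> B) sequentially"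
  shows "lr_norm r b \<le> B"
proof (rule lr_norm_leI[OF r])
  fix m
  have "(\<lambda>k. \<Sum>j<m. \<bar>a k j\<bar> powr r) \<longlonglongrightarrow> (\<Sum>j<m. \<bar>b j\<bar> powr r)"
    using r by (intro tendsto_sum tendsto_powr' tendsto_rabs lim tendsto_const) auto
  then have "(\<lambda>k. (\<Sum>j<m. \<bar>a k j\<bar> powr r) powr (1 / r)) \<longlonglongrightarrow> (\<Sum>j<m. \<bar>b j\<bar> powr r) powr (1 / r)"
    using r by (intro tendsto_powr' tendsto_const) (auto simp: sum_nonneg)
  then have "(\<lambda>k. ennreal ((\<Sum>j<m. \<bar>a k j\<bar> powr r) powr (1 / r)))
      \<longlonglongrightarrow> ennreal ((\<Sum>j<m. \<bar>b j\<bar> powr r) powr (1 / r))"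
    by (rule tendsto_ennrealI)
  moreover have "eventually (\<lambda>k. ennreal ((\<Sum>j<m. \<bar>a k j\<bar> powr r) powr (1 / r)) \<le> B) sequentially"
    using le by eventually_elim (rule order_trans[OF sum_powr_le_lr_norm[OF r]])
  ultimately show "ennreal ((\<Sum>j<m. \<bar>b j\<bar> powr r) powr (1 / r)) \<le> B"
    by (rule tendsto_upperbound) simp
qed

section \<open>Hoelder and Minkowski inequalities up to constants\<close>

lemma powr_mult_le_add_powr:
  fixes c w r :: real
  assumes "r \<ge> 1" "0 \<le> c" "0 \<le> w"
  shows "c powr (r - 1) * w \<le> c powr r + w powr r"
proof (cases "c \<le> w")
  case True
  have "c powr (r - 1) * w \<le> w powr (r - 1) * w"
    using assms True by (intro mult_right_mono powr_mono2) auto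
  also have "\<dots> = w powr r" using assms powr_mult_base[of w "r - 1"] by (simp add: mult.commute)
  finally show ?thesis by (simp add: add_increasing)
next
  case False
  have "c powr (r - 1) * w \<le> c powr (r - 1) * c"
    using assms False by (intro mult_left_mono) auto
  also have "\<dots> = c powr r" using assms powr_mult_base[of c "r - 1"] by (simp add: mult.commute)
  finally show ?thesis by (simp add: add_increasing2)
qed

text \<open>The dual of the \<open>l\<^sup>r\<close>-norm, up to the factor 2 that makes Hoelder's inequality trivial.\<close>
lemma sum_powr_dual_le:
  fixes c v :: "nat \<Rightarrow> real"
  assumes r: "r \<ge> 1" and c: "\<And>j. 0 \<le> c j" "(\<Sum>j<m. c j powr r) = 1" and v: "\<And>j. 0 \<le> v j"
  shows "(\<Sum>j<m. c j powr (r - 1) * v j) \<le> 2 * (\<Sum>j<m. v j powr r) powr (1 / r)"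
proof -
  define S where "S = (\<Sum>j<m. v j powr r)"
  define V where "V = S powr (1 / r)"
  have S0: "S \<ge> 0" by (simp add: S_def sum_nonneg)
  show ?thesis
  proof (cases "S = 0")
    case True
    then have "\<forall>j<m. v j = 0" unfolding S_def by (subst (asm) sum_nonneg_eq_0_iff) auto
    then show ?thesis by simp
  next
    case False
    with S0 have V: "V > 0" "V powr r = S" using r by (auto simp: V_def powr_powr)
    \<comment> \<open>Young's inequality for \<open>v\<close> normalised by its norm
      \<open>V\<close>: both resulting sums equal 1, whence the factor 2.\<close>
    have "(\<Sum>j<m. c j powr (r - 1) * (v j / V)) \<le> (\<Sum>j<m. c j powr r + (v j / V) powr r)"
      using r c v V by (intro sum_mono powr_mult_le_add_powr) auto
    also have "\<dots> = 1 + S / V powr r"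
      using v V by (simp add: sum.distrib c powr_divide S_def flip: sum_divide_distrib)
    also have "\<dots> = 2" using V False S0 by simp
    finally show ?thesis using V
      by (simp add: field_simps V_def S_def flip: sum_divide_distrib)
  qed
qed

lemma lr_norm_integral_le:
  assumes r: "r > 1" and f: "\<And>j. integrable M (f j)"
  shows "lr_norm r (\<lambda>j. \<integral>x. f j x \<partial>M) \<le> 2 * (\<integral>\<^sup>+x. lr_norm r (\<lambda>j. f j x) \<partial>M)"
proof (rule lr_norm_leI)
  show "r > 0" using r by simp
  fix m
  have [measurable]: "\<And>j. f j \<in> borel_measurable M" using f by blast
  define a where "a j = \<bar>\<integral>x. f j x \<partial>M\<bar>" for j
  define S where "S = (\<Sum>j<m. a j powr r)"
  define s where "s = S powr (1 / r)"
  have S0: "S \<ge> 0" by (simp add: S_def sum_nonneg)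
  show "ennreal ((\<Sum>j<m. \<bar>\<integral>x. f j x \<partial>M\<bar> powr r) powr (1 / r)) \<le> 2 * (\<integral>\<^sup>+x. lr_norm r (\<lambda>j. f j x) \<partial>M)"
  proof (cases "S = 0")
    case True then show ?thesis by (simp add: S_def a_def)
  next
    case False
    with S0 have s: "s > 0" "s powr r = S" using r by (auto simp: s_def powr_powr)
    \<comment> \<open>\<open>c\<close> is the sequence of absolute integrals normalised in
      \<open>l^r\<close>, and the weights \<open>c j powr (r - 1)\<close> form the functional that
      norms it. Testing against them turns the norm of the integrals into one integral of a finite
      sum.\<close>
    define c where "c j = a j / s" for j
    have a0: "a j \<ge> 0" for j by (simp add: a_def)
    have c0: "c j \<ge> 0" for j using s by (simp add: c_def a0)
    have c1: "(\<Sum>j<m. c j powr r) = 1"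
      using s False by (simp add: c_def powr_divide a0 S_def flip: sum_divide_distrib)
    have "s = s * (\<Sum>j<m. c j powr (r - 1) * c j)"
      using c1 powr_mult_base[OF c0, where y = "r - 1"] by (simp add: mult.commute)
    also have "\<dots> = (\<Sum>j<m. c j powr (r - 1) * a j)"
      using s by (simp add: c_def sum_distrib_left field_simps)
    finally have "ennreal s = (\<Sum>j<m. ennreal (c j powr (r - 1)) * ennreal (a j))"
      by (simp add: a0 flip: ennreal_mult)
    also have "\<dots> \<le> (\<Sum>j<m. ennreal (c j powr (r - 1)) * (\<integral>\<^sup>+x. ennreal \<bar>f j x\<bar> \<partial>M))"
      unfolding a_def using integral_norm_bound_ennreal[OF f]
      by (intro sum_mono mult_left_mono) auto
    also have "\<dots> = (\<integral>\<^sup>+x. (\<Sum>j<m. ennreal (c j powr (r - 1)) * ennreal \<bar>f j x\<bar>) \<partial>M)"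
      by (simp add: nn_integral_sum nn_integral_cmult)
    also have "\<dots> \<le> (\<integral>\<^sup>+x. 2 * lr_norm r (\<lambda>j. f j x) \<partial>M)"
    proof (rule nn_integral_mono)
      fix x
      have "(\<Sum>j<m. ennreal (c j powr (r - 1)) * ennreal \<bar>f j x\<bar>)
          = ennreal (\<Sum>j<m. c j powr (r - 1) * \<bar>f j x\<bar>)"
        by (simp flip: ennreal_mult)
      also have "\<dots> \<le> ennreal (2 * (\<Sum>j<m. \<bar>f j x\<bar> powr r) powr (1 / r))"
        using r c0 c1 by (intro ennreal_leI sum_powr_dual_le) auto
      also have "\<dots> = 2 * ennreal ((\<Sum>j<m. \<bar>f j x\<bar> powr r) powr (1 / r))"
        by (simp add: ennreal_mult)
      also have "\<dots> \<le> 2 * lr_norm r (\<lambda>j. f j x)"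
        using r by (intro mult_left_mono sum_powr_le_lr_norm) auto
      finally show "(\<Sum>j<m. ennreal (c j powr (r - 1)) * ennreal \<bar>f j x\<bar>) \<le> 2 * lr_norm r (\<lambda>j. f j x)" .
    qed
    also have "\<dots> = 2 * (\<integral>\<^sup>+x. lr_norm r (\<lambda>j. f j x) \<partial>M)"
      using r by (intro nn_integral_cmult) measurable
    finally show ?thesis by (simp add: s_def S_def a_def)
  qed
qed

text \<open>Either \<open>x \<le> \<alpha>\<close>, or \<open>x / \<alpha>\<close> exceeds 1 and is
  dominated by its power \<open>q\<close>. Integrated over a set and optimised in
  \<open>\<alpha>\<close>, this is Hoelder's inequality up to the factor 2.\<close>

lemma le_add_epowr:
  assumes "q \<ge> 1" "\<alpha> > 0"
  shows "x \<le> ennreal \<alpha> + ennreal (\<alpha> powr (1 - q)) * epowr x q"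
proof (cases x)
  case (real y)
  show ?thesis
  proof (cases "y \<le> \<alpha>")
    case True
    then show ?thesis using real by (simp add: ennreal_leI add_increasing2)
  next
    case False
    have "y = \<alpha> * (y / \<alpha>) powr 1" using assms real by simp
    also have "\<dots> \<le> \<alpha> * (y / \<alpha>) powr q"
      using assms False by (intro mult_left_mono powr_mono) auto
    also have "\<dots> = \<alpha> powr (1 - q) * y powr q"
      using assms real by (simp add: powr_divide powr_diff)
    finally have "x \<le> ennreal (\<alpha> powr (1 - q)) * epowr x q"
      using real by (simp add: epowr_ennreal ennreal_leI flip: ennreal_mult)
    then show ?thesis by (simp add: add_increasing)
  qed
qed (use assms in \<open>auto simp: ennreal_mult_top\<close>)

lemma nn_integral_le_epowr:
  assumes q: "q \<ge> 1" and [measurable]: "A \<in> sets M" "F \<in> borel_measurable M"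
    and w: "emeasure M A = ennreal w" "0 < w"
  shows "(\<integral>\<^sup>+x\<in>A. F x \<partial>M) \<le> ennreal (2 * w powr (1 - 1 / q)) * epowr (\<integral>\<^sup>+x\<in>A. epowr (F x) q \<partial>M) (1 / q)"
proof (cases "(\<integral>\<^sup>+x\<in>A. epowr (F x) q \<partial>M)")
  case top
  then show ?thesis using w by (simp add: ennreal_mult_top)
next
  case (real I)
  have *: "(\<integral>\<^sup>+x\<in>A. F x \<partial>M) \<le> ennreal (2 * \<alpha> * w)" if \<alpha>: "\<alpha> > 0" "I \<le> w * \<alpha> powr q" for \<alpha>
  proof -
    have "(\<integral>\<^sup>+x\<in>A. F x \<partial>M) \<le> (\<integral>\<^sup>+x. ennreal \<alpha> * indicator A x
        + ennreal (\<alpha> powr (1 - q)) * (epowr (F x) q * indicator A x) \<partial>M)"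
      using le_add_epowr[OF q \<alpha>(1)] by (intro nn_integral_mono) (auto split: split_indicator)
    also have "\<dots> = ennreal \<alpha> * ennreal w + ennreal (\<alpha> powr (1 - q)) * ennreal I"
      by (simp add: nn_integral_add nn_integral_cmult real w)
    also have "\<dots> = ennreal (\<alpha> * w + \<alpha> powr (1 - q) * I)"
      using \<alpha> w real by (simp add: ennreal_mult ennreal_plus)
    also have "\<dots> \<le> ennreal (\<alpha> * w + \<alpha> powr (1 - q) * (w * \<alpha> powr q))"
      using \<alpha> by (intro ennreal_leI add_mono mult_left_mono) auto
    also have "\<dots> = ennreal (2 * \<alpha> * w)"
      using \<alpha> by (simp add: powr_diff mult.assoc)
    finally show ?thesis .
  qed
  \<comment> \<open>\<open>\<beta>\<close> balances the two terms, but it is 0 if \<open>I\<close>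
    is. So the estimate is applied for \<open>\<alpha> > \<beta>\<close>, and
    \<open>\<alpha>\<close> tends to \<open>\<beta>\<close> from the right.\<close>
  define \<beta> where "\<beta> = (I / w) powr (1 / q)"
  have "(\<integral>\<^sup>+x\<in>A. F x \<partial>M) \<le> ennreal (2 * \<beta> * w)"
  proof (rule tendsto_lowerbound)
    have "((\<lambda>\<alpha>. ennreal (2 * \<alpha> * w)) \<longlongrightarrow> ennreal (2 * \<beta> * w)) (at_right \<beta>)"
      by (intro tendsto_ennrealI tendsto_intros)
    then show "((\<lambda>\<alpha>. ennreal (2 * \<alpha> * w)) \<longlongrightarrow> ennreal (2 * \<beta> * w)) (at_right \<beta>)" .
    show "eventually (\<lambda>\<alpha>. (\<integral>\<^sup>+x\<in>A. F x \<partial>M) \<le> ennreal (2 * \<alpha> * w)) (at_right \<beta>)"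
      unfolding eventually_at_right_field
    proof (intro exI[of _ "\<beta> + 1"] conjI allI impI)
      fix \<alpha> assume "\<beta> < \<alpha>"
      have "\<beta> \<ge> 0" by (simp add: \<beta>_def)
      have "I / w = \<beta> powr q" using real w q by (simp add: \<beta>_def powr_powr)
      also have "\<dots> \<le> \<alpha> powr q" using \<open>\<beta> < \<alpha>\<close> \<open>\<beta> \<ge> 0\<close> q by (intro powr_mono2) auto
      finally show "(\<integral>\<^sup>+x\<in>A. F x \<partial>M) \<le> ennreal (2 * \<alpha> * w)"
        using w \<open>\<beta> < \<alpha>\<close> \<open>\<beta> \<ge> 0\<close> by (intro *) (auto simp: field_simps)
    qed simp
  qed simp
  also have "2 * \<beta> * w = 2 * w powr (1 - 1 / q) * I powr (1 / q)"
    using w real by (simp add: \<beta>_def powr_divide powr_diff)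
  finally show ?thesis using real w by (simp add: epowr_ennreal ennreal_mult)
qed

lemma lr_norm_cmult:
  assumes "r > 0" "c > 0"
  shows "lr_norm r (\<lambda>j. c * a j) = ennreal c * lr_norm r a"
proof -
  have "(\<Sum>j. ennreal (\<bar>c * a j\<bar> powr r)) = ennreal (c powr r) * (\<Sum>j. ennreal (\<bar>a j\<bar> powr r))"
    using assms by (simp add: abs_mult powr_mult ennreal_mult)
  then show ?thesis
    using assms by (simp add: lr_norm_eq epowr_cmult powr_powr)
qed

lemma lr_norm_diff_le:
  assumes "r \<ge> 1"
  shows "lr_norm r (\<lambda>j. a j - b j) \<le> 4 * (lr_norm r a + lr_norm r b)"
  using lr_norm_add_le[OF assms, of a "\<lambda>j. - b j"] by (simp add: lr_norm_uminus)

lemma le_divide_ennreal: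
  assumes "a > 0" "ennreal a * x \<le> y"
  shows "x \<le> ennreal (1 / a) * y"
proof -
  have "x = ennreal (1 / a) * (ennreal a * x)"
    using assms(1) by (simp add: mult.assoc[symmetric] flip: ennreal_mult)
  also have "\<dots> \<le> ennreal (1 / a) * y"
    using assms(2) by (intro mult_left_mono) auto
  finally show ?thesis .
qed

section \<open>Cubes and measures of polynomial growth\<close>

lemma cube_set_ereal: "cube_set (z, ereal t) = {y. \<forall>i. \<bar>y$i - z$i\<bar> \<le> t / 2}"
  by (simp add: cube_set_def)

lemma cube_set_infinity: "cube_set (z, \<infinity>) = UNIV"
  by (simp add: cube_set_def)

lemma cube_set_ereal_cbox: "cube_set (z, ereal t) = cbox (\<chi> i. z$i - t / 2) (\<chi> i. z$i + t / 2)"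
proof -
  have "\<bar>a - b\<bar> \<le> t / 2 \<longleftrightarrow> b - t / 2 \<le> a \<and> a \<le> b + t / 2" for a b :: real
    by linarith
  then show ?thesis unfolding cube_set_ereal set_eq_iff mem_box_cart mem_Collect_eq vec_lambda_beta by simp
qed

lemma closed_cube_set: "closed (cube_set Q)"
proof (cases "snd Q = \<infinity>")
  case False
  then have "cube_set Q = cube_set (fst Q, ereal (real_of_ereal (snd Q)))"
    by (simp add: cube_set_def)
  then show ?thesis by (simp add: cube_set_ereal_cbox closed_cbox)
qed (simp add: cube_set_def)

lemma cube_set_mono: "s \<le> t \<Longrightarrow> cube_set (z, ereal s) \<subseteq> cube_set (z, ereal t)"
  by (auto simp: cube_set_ereal intro: order_trans)

lemma dil_ereal: "dil c (z, ereal l) = (z, ereal (c * l))"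
  by (simp add: dil_def)

lemma dil_infinity: "c > 0 \<Longrightarrow> dil c (z, \<infinity>) = (z, \<infinity>)"
  by (simp add: dil_def)

lemma Qmu_cases:
  assumes "Q \<in> Qmu M"
  obtains z l where "Q = (z, ereal l)" "0 < l"
  | z where "Q = (z, \<infinity>)" "emeasure M UNIV < \<infinity>"
  using assms by (cases Q; cases "snd Q") (auto simp: Qmu_def)

lemma side_QR_le: "0 < l \<Longrightarrow> cube_set R \<subseteq> cube_set (z, ereal l) \<Longrightarrow> side_QR (z, s) R \<le> ereal l"
  unfolding side_QR_def by (intro Inf_lower) auto

section \<open>Measures of polynomial growth and doubling cubes\<close>

locale growth_measure =
  fixes M :: "(real^'d::finite) measure" and C0 n :: real
  assumes radon: "radon M" and C0: "C0 > 0" and n: "0 < n" "n \<le> real CARD('d)"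
    and growth: "growth M C0 n"
begin

lemma sets_M [measurable_cong]: "sets M = sets borel"
  using radon by (simp add: radon_def)

lemma space_M [simp]: "space M = UNIV"
  using sets_eq_imp_space_eq[OF sets_M] by simp

lemma cube_set_sets [measurable]: "cube_set Q \<in> sets M"
  unfolding sets_M by (rule borel_closed[OF closed_cube_set])

lemma emeasure_compact: "compact K \<Longrightarrow> emeasure M K < \<infinity>"
  using radon by (simp add: radon_def)

lemma emeasure_cube: "emeasure M (cube_set (z, ereal l)) = ennreal (measure M (cube_set (z, ereal l)))"
  using emeasure_compact[of "cube_set (z, ereal l)"]
  by (intro emeasure_eq_ennreal_measure) (auto simp: cube_set_ereal_cbox)

lemma emeasure_Qmu:
  assumes "Q \<in> Qmu M"
  shows "emeasure M (cube_set Q) = ennreal (measure M (cube_set Q))" "0 < measure M (cube_set Q)"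
proof -
  show *: "emeasure M (cube_set Q) = ennreal (measure M (cube_set Q))"
    using assms
  proof (cases rule: Qmu_cases)
    case (2 z)
    then show ?thesis by (intro emeasure_eq_ennreal_measure) (auto simp: cube_set_infinity)
  qed (simp add: emeasure_cube)
  from assms have "emeasure M (cube_set Q) > 0" by (simp add: Qmu_def)
  with * show "0 < measure M (cube_set Q)" by simp
qed

lemma measure_mono_Qmu:
  assumes "R \<in> Qmu M" "cube_set Q \<subseteq> cube_set R"
  shows "measure M (cube_set Q) \<le> measure M (cube_set R)"
  using assms emeasure_Qmu[OF assms(1)] by (intro measure_mono_fmeasurable) (auto simp: fmeasurable_def)

lemma measure_cube_mono:
  "s \<le> t \<Longrightarrow> measure M (cube_set (z, ereal s)) \<le> measure M (cube_set (z, ereal t))"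
  using cube_set_mono[of s t z] emeasure_cube[of z t]
  by (intro measure_mono_fmeasurable) (auto simp: fmeasurable_def)

lemma Qmu_ereal_iff: "(z, ereal l) \<in> Qmu M \<longleftrightarrow> 0 < l \<and> 0 < measure M (cube_set (z, ereal l))"
  by (simp add: Qmu_def emeasure_cube)

lemma dil_Qmu:
  assumes "Q \<in> Qmu M" "1 \<le> c"
  shows "dil c Q \<in> Qmu M" "cube_set Q \<subseteq> cube_set (dil c Q)"
proof -
  have "dil c Q \<in> Qmu M \<and> cube_set Q \<subseteq> cube_set (dil c Q)"
    using assms(1)
  proof (cases rule: Qmu_cases)
    case (1 z l)
    then have "l \<le> c * l" using assms by simp
    then show ?thesis
      using 1 assms cube_set_mono[of l "c * l" z] measure_cube_mono[of l "c * l" z]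
      by (auto simp: dil_ereal Qmu_ereal_iff)
  qed (use assms in \<open>auto simp: dil_infinity\<close>)
  then show "dil c Q \<in> Qmu M" "cube_set Q \<subseteq> cube_set (dil c Q)" by auto
qed

lemma doubling_iff:
  assumes "Q \<in> Qmu M"
  shows "doubling M Q \<longleftrightarrow> measure M (cube_set (dil 2 Q)) \<le> 2 ^ (CARD('d) + 1) * measure M (cube_set Q)"
proof -
  have "(2::ennreal) ^ (CARD('d) + 1) = ennreal (2 ^ (CARD('d) + 1))"
    by (metis ennreal_numeral ennreal_power zero_le_numeral)
  then show ?thesis
    using assms emeasure_Qmu[OF assms] emeasure_Qmu[OF dil_Qmu(1)[OF assms, of 2]]
    by (simp add: doubling_def flip: ennreal_mult)
qed

text \<open>A compact set off the support is covered by finitely many null balls. This disposes of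
  the cubes about which \<open>growth\<close> says nothing.\<close>

lemma null_set_if_disjnt_msupp:
  assumes "compact K" "K \<inter> msupp M = {}"
  shows "emeasure M K = 0"
proof -
  have "\<exists>e. 0 < e \<and> emeasure M (ball x e) = 0" if "x \<in> K" for x
  proof -
    have "x \<notin> msupp M" using assms(2) that by blast
    then show ?thesis unfolding msupp_def by (auto simp: zero_less_iff_neq_zero)
  qed
  then obtain e where e: "\<And>x. x \<in> K \<Longrightarrow> 0 < e x \<and> emeasure M (ball x (e x)) = 0"
    by metis
  obtain T where T: "T \<subseteq> K" "finite T" "K \<subseteq> (\<Union>x\<in>T. ball x (e x))"
    by (rule compactE_image[OF assms(1), of K "\<lambda>x. ball x (e x)"]) (use e in auto)
  have "(\<Union>x\<in>T. ball x (e x)) \<in> null_sets M"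
    using T e by (intro null_sets.finite_UN) (auto simp: null_sets_def sets_M)
  moreover have "K \<in> sets M" using assms(1) by (simp add: sets_M compact_imp_closed)
  ultimately have "K \<in> null_sets M" using T(3) by (metis null_sets_subset)
  then show ?thesis by auto
qed

definition growth_const :: real where "growth_const = C0 * 2 powr n"

lemma growth_const_pos: "growth_const > 0"
  using C0 by (simp add: growth_const_def)

text \<open>\<open>growth\<close> controls only cubes centred in the support. A cube of side
  \<open>t\<close> that meets the support lies in one of side \<open>2 * t\<close> centred at a
  support point, which is the origin of \<open>growth_const\<close>; a cube that misses the support
  is null.\<close>

lemma measure_cube_le:
  assumes "t > 0"
  shows "measure M (cube_set (z, ereal t)) \<le> growth_const * t powr n"
proof (cases "cube_set (z, ereal t) \<inter> msupp M = {}")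
  case True
  then have "emeasure M (cube_set (z, ereal t)) = 0"
    by (intro null_set_if_disjnt_msupp) (simp_all add: cube_set_ereal_cbox)
  then show ?thesis using growth_const_pos by (simp add: measure_def)
next
  case False
  then obtain x where x: "x \<in> cube_set (z, ereal t)" "x \<in> msupp M" by blast
  have "cube_set (z, ereal t) \<subseteq> cube_set (x, ereal (2 * t))"
  proof
    fix y assume y: "y \<in> cube_set (z, ereal t)"
    have "\<bar>y$i - x$i\<bar> \<le> t" for i
    proof -
      have "\<bar>y$i - z$i\<bar> \<le> t / 2" "\<bar>x$i - z$i\<bar> \<le> t / 2"
        using x(1) y by (auto simp: cube_set_ereal)
      then show ?thesis by linarith
    qed
    then show "y \<in> cube_set (x, ereal (2 * t))" by (simp add: cube_set_ereal)
  qed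
  then have "emeasure M (cube_set (z, ereal t)) \<le> emeasure M (cube_set (x, ereal (2 * t)))"
    by (intro emeasure_mono) auto
  also have "\<dots> \<le> ennreal (C0 * (2 * t) powr n)"
    using growth x(2) assms by (auto simp: growth_def Qc_def)
  finally show ?thesis
    using assms C0 by (simp add: emeasure_cube growth_const_def powr_mult mult.assoc)
qed

text \<open>Without doubling dilates, each dilation by 2 would multiply the measure by more than
  \<open>2 ^ (d + 1)\<close>, whereas polynomial growth permits \<open>2 powr n \<le> 2 ^ d\<close>
  per step on average; the spare factor 2 accumulates. The whole space is its own dilate, hence
  doubling.\<close>

lemma ex_doubling_dil:
  assumes "Q \<in> Qmu M"
  shows "\<exists>j::nat. doubling M (dil (2 ^ j) Q)"
  using assms
proof (cases rule: Qmu_cases)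
  case (1 z l)
  define \<phi> where "\<phi> t = measure M (cube_set (z, ereal t))" for t
  have \<phi>0: "\<phi> l > 0" using assms 1 by (simp add: Qmu_ereal_iff \<phi>_def)
  show ?thesis
  proof (rule ccontr)
    assume "\<not> ?thesis"
    then have nd: "\<not> doubling M (z, ereal (2 ^ j * l))" for j by (simp add: 1 dil_ereal)
    have step: "2 ^ (CARD('d) + 1) * \<phi> (2 ^ j * l) \<le> \<phi> (2 ^ Suc j * l)" for j
    proof -
      have "(z, ereal (2 ^ j * l)) \<in> Qmu M" using dil_Qmu(1)[OF assms, of "2 ^ j"] 1 by (simp add: dil_ereal)
      then show ?thesis using nd[of j] by (simp add: doubling_iff dil_ereal \<phi>_def mult.assoc)
    qed
    have grow: "(2 ^ (CARD('d) + 1)) ^ j * \<phi> l \<le> \<phi> (2 ^ j * l)" for j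
    proof (induction j)
      case (Suc j)
      have "(2 ^ (CARD('d) + 1)) ^ Suc j * \<phi> l = 2 ^ (CARD('d) + 1) * ((2 ^ (CARD('d) + 1)) ^ j * \<phi> l)"
        by simp
      also have "\<dots> \<le> 2 ^ (CARD('d) + 1) * \<phi> (2 ^ j * l)" using Suc by (intro mult_left_mono) auto
      finally show ?case using step[of j] by linarith
    qed simp
    have bound: "2 ^ j * \<phi> l \<le> growth_const * l powr n" for j
    proof -
      have "2 ^ j * \<phi> l * (2 ^ CARD('d)) ^ j = (2 ^ (CARD('d) + 1)) ^ j * \<phi> l"
        by (simp add: power_mult_distrib)
      also have "\<dots> \<le> growth_const * (2 ^ j * l) powr n"
        using grow[of j] measure_cube_le[of "2 ^ j * l" z] 1 by (simp add: \<phi>_def)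
      also have "\<dots> = growth_const * l powr n * (2 powr n) ^ j"
        using 1 by (simp add: powr_mult powr_realpow[symmetric] powr_powr mult.commute)
      also have "\<dots> \<le> growth_const * l powr n * (2 ^ CARD('d)) ^ j"
        using powr_mono[OF n(2), of 2] growth_const_pos
        by (intro mult_left_mono power_mono) (auto simp: powr_realpow)
      finally show ?thesis by simp
    qed
    obtain j where "growth_const * l powr n / \<phi> l < 2 ^ j" using real_arch_pow[of 2] by auto
    then show False using bound[of j] \<phi>0 by (simp add: field_simps)
  qed
next
  case (2 z)
  have "1 * measure M (cube_set Q) \<le> 2 ^ (CARD('d) + 1) * measure M (cube_set Q)"
    by (intro mult_right_mono one_le_power) auto
  then have "doubling M Q"
    using assms 2 by (simp add: doubling_iff dil_infinity)
  then have "doubling M (dil (2 ^ 0) Q)" using 2 by (simp add: dil_infinity)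
  then show ?thesis by blast
qed

lemma doubling_dstar:
  assumes "Q \<in> Qmu M"
  shows "doubling M (dstar M Q)" "cube_set Q \<subseteq> cube_set (dstar M Q)"
proof -
  show "doubling M (dstar M Q)"
    unfolding dstar_def by (rule LeastI_ex[OF ex_doubling_dil[OF assms]])
  show "cube_set Q \<subseteq> cube_set (dstar M Q)"
    unfolding dstar_def by (intro dil_Qmu(2)[OF assms]) simp
qed

section \<open>Bounds for the coefficients K\<close>

lemma delta_le_suminf:
  assumes l: "l > 0"
  shows "delta M n (z, ereal l) R \<le> (\<Sum>i. if ereal (2 ^ i * l) \<le> side_QR (z, ereal l) R
     then ennreal (measure M (cube_set (z, ereal (2 ^ Suc i * l))) * (2 ^ i * l) powr (- n)) else 0)"
proof -
  let ?S = "side_QR (z, ereal l) R"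
  define \<phi> where "\<phi> t = measure M (cube_set (z, ereal t))" for t
  define c where "c i = (if ereal (2 ^ i * l) \<le> ?S
     then ennreal (\<phi> (2 ^ Suc i * l) * (2 ^ i * l) powr (- n)) else 0)" for i :: nat
  \<comment> \<open>On the dyadic shell \<open>B i\<close> the measure is taken at the right end and
    the powers at the left end. The left end is also the length of the shell, which cancels
    \<open>1 / (2 ^ i * l)\<close> after integration.\<close>
  define B where "B i = {2 ^ i * l..<2 ^ Suc i * l}" for i :: nat
  have pointwise: "indicator {t. ereal l \<le> ereal t \<and> ereal t \<le> ?S} t * ennreal (\<phi> t) * ennreal (t powr (- n) / t)
     \<le> (\<Sum>i. ennreal (1 / (2 ^ i * l)) * c i * indicator (B i) t)" for t
  proof (cases "l \<le> t \<and> ereal t \<le> ?S")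
    case True
    obtain k where "t / l < 2 ^ k" using real_arch_pow[of 2] by auto
    then have "\<exists>k::nat. t < 2 ^ k * l" using l by (auto simp: field_simps)
    then obtain m where m: "t < 2 ^ m * l" "\<And>k. k < m \<Longrightarrow> \<not> t < 2 ^ k * l"
      using exists_least_iff[of "\<lambda>k::nat. t < 2 ^ k * l"] by blast
    with True obtain i where i: "m = Suc i" by (cases m) auto
    have t: "2 ^ i * l \<le> t" "t < 2 ^ Suc i * l" using m i by (auto simp: not_less)
    have i0: "0 < 2 ^ i * l" using l by simp
    have "ereal (2 ^ i * l) \<le> ?S" using t(1) True by (metis ereal_less_eq(3) order_trans)
    then have c: "c i = ennreal (\<phi> (2 ^ Suc i * l) * (2 ^ i * l) powr (- n))" by (simp add: c_def)
    have "\<phi> t * (t powr (- n) / t) \<le> \<phi> (2 ^ Suc i * l) * ((2 ^ i * l) powr (- n) / (2 ^ i * l))"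
      using t i0 n measure_cube_mono[of t "2 ^ Suc i * l" z]
      by (intro mult_mono frac_le powr_mono2') (auto simp: \<phi>_def)
    then have "indicator {t. ereal l \<le> ereal t \<and> ereal t \<le> ?S} t * ennreal (\<phi> t) * ennreal (t powr (- n) / t)
        \<le> ennreal (1 / (2 ^ i * l)) * c i * indicator (B i) t"
      using True t i0 unfolding c B_def by (simp add: \<phi>_def ennreal_leI flip: ennreal_mult)
    also have "\<dots> = (\<Sum>k\<in>{i}. ennreal (1 / (2 ^ k * l)) * c k * indicator (B k) t)"
      by (simp only: sum.insert finite.emptyI sum.empty empty_iff not_False_eq_True add_0_right)
    also have "\<dots> \<le> (\<Sum>i. ennreal (1 / (2 ^ i * l)) * c i * indicator (B i) t)"
      by (rule sum_le_suminf) auto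
    finally show ?thesis .
  qed auto
  have "delta M n (z, ereal l) R
     = (\<integral>\<^sup>+t. indicator {t. ereal l \<le> ereal t \<and> ereal t \<le> ?S} t * ennreal (\<phi> t) * ennreal (t powr (- n) / t) \<partial>lborel)"
    by (simp add: delta_def Qc_def emeasure_cube \<phi>_def)
  also have "\<dots> \<le> (\<integral>\<^sup>+t. (\<Sum>i. ennreal (1 / (2 ^ i * l)) * c i * indicator (B i) t) \<partial>lborel)"
    by (intro nn_integral_mono pointwise)
  also have "\<dots> = (\<Sum>i. \<integral>\<^sup>+t. ennreal (1 / (2 ^ i * l)) * c i * indicator (B i) t \<partial>lborel)"
    by (intro nn_integral_suminf) (simp add: B_def)
  also have "\<dots> = (\<Sum>i. c i)"
  proof (rule arg_cong[where f = suminf], rule ext)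
    fix i
    have "(\<integral>\<^sup>+t. ennreal (1 / (2 ^ i * l)) * c i * indicator (B i) t \<partial>lborel)
       = ennreal (1 / (2 ^ i * l)) * c i * ennreal (2 ^ Suc i * l - 2 ^ i * l)"
      using l by (subst nn_integral_cmult_indicator) (auto simp: B_def)
    also have "\<dots> = c i * (ennreal (1 / (2 ^ i * l)) * ennreal (2 ^ i * l))"
      by (simp add: mult.commute mult.left_commute)
    also have "ennreal (1 / (2 ^ i * l)) * ennreal (2 ^ i * l) = 1"
      using l by (simp flip: ennreal_mult)
    finally show "(\<integral>\<^sup>+t. ennreal (1 / (2 ^ i * l)) * c i * indicator (B i) t \<partial>lborel) = c i" by simp
  qed
  finally show ?thesis unfolding c_def \<phi>_def .
qed

text \<open>The 1 is the one in \<open>Kqr\<close>, and the quotient sums a geometric series of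
  ratio \<open>2 powr (- n)\<close>. A single dyadic summand is at most
  \<open>2 powr n * growth_const\<close>: twice this sums the series that increases up to the next
  chain cube, three times this covers the indices from that cube to its dilate by 4.\<close>

definition Kqr_bound :: "real \<Rightarrow> real" where
  "Kqr_bound A = 1 + A * growth_const / (1 - 2 powr (- n)) + 5 * (2 powr n * growth_const)"

lemma Kqr_bound_pos: "A \<ge> 0 \<Longrightarrow> Kqr_bound A > 0"
proof -
  assume "A \<ge> 0"
  moreover have "2 powr (- n) < 1" using n by (simp add: powr_less_one)
  ultimately show ?thesis
    using growth_const_pos unfolding Kqr_bound_def by (intro add_pos_nonneg) auto
qed

lemma sum_geometric_le:
  fixes x :: real
  assumes "0 \<le> x" "x < 1"
  shows "(\<Sum>i<m. x ^ i) \<le> 1 / (1 - x)"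
  using sum_le_suminf[of "(^) x" "{..<m}"] suminf_geometric[of x] summable_geometric[of x] assms by auto

lemma Kqr_le:
  assumes l: "l > 0"
    and le: "\<And>m. (\<Sum>i<m. if ereal (2 ^ i * l) \<le> side_QR (z, ereal l) R
     then measure M (cube_set (z, ereal (2 ^ Suc i * l))) * (2 ^ i * l) powr (- n) else 0) \<le> D"
  shows "Kqr M n (z, ereal l) R \<le> ennreal (1 + D)"
proof -
  have "0 \<le> D" using le[of 0] by simp
  have "delta M n (z, ereal l) R \<le> ennreal D"
    using delta_le_suminf[OF l]
  proof (rule order_trans, intro suminf_le_const)
    fix m
    have "(\<Sum>i<m. if ereal (2 ^ i * l) \<le> side_QR (z, ereal l) R
        then ennreal (measure M (cube_set (z, ereal (2 ^ Suc i * l))) * (2 ^ i * l) powr (- n)) else 0)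
      = (\<Sum>i<m. ennreal (if ereal (2 ^ i * l) \<le> side_QR (z, ereal l) R
        then measure M (cube_set (z, ereal (2 ^ Suc i * l))) * (2 ^ i * l) powr (- n) else 0))"
      by (intro sum.cong) auto
    also have "\<dots> \<le> ennreal D"
      using le[of m] by (subst sum_ennreal) (auto intro: ennreal_leI)
    finally show "(\<Sum>i<m. if ereal (2 ^ i * l) \<le> side_QR (z, ereal l) R
        then ennreal (measure M (cube_set (z, ereal (2 ^ Suc i * l))) * (2 ^ i * l) powr (- n)) else 0) \<le> ennreal D" .
  qed simp
  then show ?thesis
    using \<open>0 \<le> D\<close> unfolding Kqr_def by (simp add: ennreal_plus add_left_mono)
qed

text \<open>Either \<open>\<mu>\<close> never exceeds \<open>A \<mu>(Q)\<close> on the dilates of \<open>Q\<close>, or the first doubling dilate of larger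
  measure is the next cube of the chain. Up to there the summands of \<open>delta_le_suminf\<close> first decay
  geometrically, since \<open>\<mu>\<close> is bounded, and then grow geometrically, since the cubes are not doubling.\<close>
lemma next_doubling_cube:
  assumes Q: "(z, ereal l) \<in> Qmu M" and A: "A \<ge> 1"
  obtains "\<And>R. Kqr M n (z, ereal l) R \<le> ennreal (Kqr_bound A)"
  | t where "l \<le> t" "doubling M (z, ereal t)"
      "A * measure M (cube_set (z, ereal l)) \<le> measure M (cube_set (z, ereal t))"
      "\<And>R. side_QR (z, ereal l) R \<le> ereal (4 * t) \<Longrightarrow> Kqr M n (z, ereal l) R \<le> ennreal (Kqr_bound A)"
proof -
  have l: "l > 0" using Q by (simp add: Qmu_ereal_iff)
  define x where "x = 2 powr (- n)"
  have x: "0 \<le> x" "x < 1" using n by (auto simp: x_def powr_less_one)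
  define \<phi> where "\<phi> k = measure M (cube_set (z, ereal (2 ^ k * l)))" for k :: nat
  define c where "c i = \<phi> (Suc i) * (2 ^ i * l) powr (- n)" for i
  have powr_2l: "(2 ^ i * l) powr a = (2 powr a) ^ i * l powr a" for i :: nat and a
    using l by (simp add: powr_mult powr_realpow[symmetric] powr_powr mult.commute)
  have c0: "0 \<le> c i" for i by (simp add: c_def \<phi>_def)
  \<comment> \<open>Growth enters at the fixed scale \<open>l\<close> only, and the weight
    \<open>(2 ^ i * l) powr (- n)\<close> supplies the decay.\<close>
  have lower: "c i \<le> A * growth_const * x ^ i" if "\<phi> (Suc i) \<le> A * \<phi> 0" for i
  proof -
    have "c i \<le> (A * \<phi> 0) * (2 ^ i * l) powr (- n)"
      unfolding c_def using that by (intro mult_right_mono) auto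
    also have "\<dots> \<le> (A * (growth_const * l powr n)) * (2 ^ i * l) powr (- n)"
      using measure_cube_le[OF l, of z] A by (intro mult_right_mono mult_left_mono) (auto simp: \<phi>_def)
    also have "\<dots> = A * growth_const * x ^ i"
      unfolding powr_2l using l by (simp add: x_def powr_minus)
    finally show ?thesis .
  qed
  define b where "b = 2 powr n * growth_const"
  have b0: "0 \<le> b" using growth_const_pos by (simp add: b_def)
  \<comment> \<open>Growth at the scale of the dilate itself cancels the weight, so \<open>b\<close>
    depends neither on \<open>i\<close> nor on \<open>l\<close>.\<close>
  have cb: "c i \<le> b" for i
  proof -
    have "c i \<le> (growth_const * (2 ^ Suc i * l) powr n) * (2 ^ i * l) powr (- n)"
      unfolding c_def \<phi>_def using measure_cube_le[of "2 ^ Suc i * l" z] l by (intro mult_right_mono) auto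
    also have "\<dots> = b * ((2 powr n) ^ i * l powr n) * ((2 ^ i * l) powr (- n))"
      unfolding powr_2l b_def by simp
    also have "\<dots> = b * ((2 powr n) ^ i * (2 powr (- n)) ^ i) * (l powr n * l powr (- n))"
      unfolding powr_2l by (simp only: mult_ac)
    also have "\<dots> = b"
      using l by (simp add: powr_minus power_inverse)
    finally show ?thesis .
  qed
  have geo: "(\<Sum>i<m. A * growth_const * x ^ i) \<le> A * growth_const / (1 - x)" for m
    using sum_geometric_le[OF x, of m] A growth_const_pos
      mult_left_mono[of "\<Sum>i<m. x ^ i" "1 / (1 - x)" "A * growth_const"]
    by (simp flip: sum_distrib_left)
  show ?thesis
  proof (cases "\<exists>j. \<phi> j > A * \<phi> 0")
    case False
    have "Kqr M n (z, ereal l) R \<le> ennreal (1 + A * growth_const / (1 - x))" for R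
    proof (rule Kqr_le[OF l])
      fix m
      have "(if ereal (2 ^ i * l) \<le> side_QR (z, ereal l) R then c i else 0) \<le> A * growth_const * x ^ i" for i
        using lower[of i] False A growth_const_pos x by (auto simp: not_less)
      then have "(\<Sum>i<m. if ereal (2 ^ i * l) \<le> side_QR (z, ereal l) R then c i else 0)
          \<le> (\<Sum>i<m. A * growth_const * x ^ i)" by (rule sum_mono)
      then show "(\<Sum>i<m. if ereal (2 ^ i * l) \<le> side_QR (z, ereal l) R
          then measure M (cube_set (z, ereal (2 ^ Suc i * l))) * (2 ^ i * l) powr (- n) else 0)
        \<le> A * growth_const / (1 - x)" using geo[of m] unfolding c_def \<phi>_def by linarith
    qed
    also have "ennreal (1 + A * growth_const / (1 - x)) \<le> ennreal (Kqr_bound A)"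
      using b0 by (intro ennreal_leI) (simp add: Kqr_bound_def b_def x_def)
    finally show ?thesis using that(1) by blast
  next
    case True
    then obtain j where j: "\<phi> j > A * \<phi> 0" "\<And>i. i < j \<Longrightarrow> \<phi> i \<le> A * \<phi> 0"
      using exists_least_iff[of "\<lambda>j. \<phi> j > A * \<phi> 0"] by (auto simp: not_less)
    have Qmu: "(z, ereal (2 ^ i * l)) \<in> Qmu M" for i :: nat
      using dil_Qmu(1)[OF Q, of "2 ^ i"] by (simp add: dil_ereal)
    have "\<exists>J. doubling M (z, ereal (2 ^ J * l)) \<and> j \<le> J"
      using ex_doubling_dil[OF Qmu[of j]]
      by (auto simp: dil_ereal mult.assoc[symmetric] power_add[symmetric])
    \<comment> \<open>At \<open>j\<close> the measure has become large enough, but that dilate need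
      not be doubling; \<open>J\<close> is the first doubling one from there on.\<close>
    then obtain J where J: "doubling M (z, ereal (2 ^ J * l))" "j \<le> J"
        "\<And>i. j \<le> i \<Longrightarrow> i < J \<Longrightarrow> \<not> doubling M (z, ereal (2 ^ i * l))"
      using exists_least_iff[of "\<lambda>J. doubling M (z, ereal (2 ^ J * l)) \<and> j \<le> J"] by blast
    \<comment> \<open>Failure of doubling gains at least \<open>2 * 2 powr n\<close> in measure:
      \<open>2 powr n\<close> compensates the smaller weight, and a factor 2 is left.\<close>
    have half: "c i \<le> c (Suc i) / 2" if "j \<le> Suc i" "Suc i < J" for i
    proof -
      have "2 * 2 powr n * \<phi> (Suc i) \<le> 2 ^ (CARD('d) + 1) * \<phi> (Suc i)"
        using powr_mono[OF n(2), of 2] by (intro mult_right_mono) (auto simp: powr_realpow \<phi>_def)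
      also have "\<dots> \<le> \<phi> (Suc (Suc i))"
        using J(3)[OF that] Qmu[of "Suc i"] by (simp add: doubling_iff dil_ereal \<phi>_def mult.assoc)
      finally have "2 * 2 powr n * \<phi> (Suc i) * ((2 ^ Suc i * l) powr (- n)) \<le> c (Suc i)"
        unfolding c_def by (intro mult_right_mono) auto
      moreover have "2 powr n * (2 ^ Suc i * l) powr (- n) = (2 ^ i * l) powr (- n)"
        unfolding powr_2l by (simp add: powr_minus)
      ultimately show ?thesis by (simp add: c_def mult.assoc mult.left_commute)
    qed
    \<comment> \<open>Induction backwards from \<open>i = J - 1\<close>, where the uniform bound
      \<open>b\<close> is used.\<close>
    have upper: "c i \<le> b * (1 / 2) ^ (J - Suc i)" if "j \<le> Suc i" "i < J" for i
      using that
    proof (induction "J - Suc i" arbitrary: i)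
      case 0
      then show ?case using cb[of i] by simp
    next
      case (Suc k)
      then have "Suc i < J" by linarith
      moreover have "J - Suc i = Suc (J - Suc (Suc i))" using \<open>Suc i < J\<close> by linarith
      moreover have "c (Suc i) \<le> b * (1 / 2) ^ (J - Suc (Suc i))" using Suc \<open>Suc i < J\<close> by auto
      ultimately show ?case using half[of i] Suc.prems by simp
    qed
    have "Kqr M n (z, ereal l) R \<le> ennreal (1 + (A * growth_const / (1 - x) + 5 * b))"
      if R: "side_QR (z, ereal l) R \<le> ereal (4 * (2 ^ J * l))" for R
    proof (rule Kqr_le[OF l])
      fix m
      let ?u = "\<lambda>i. if i < J then b * (1 / 2) ^ (J - Suc i) else 0"
      let ?v = "\<lambda>i. if i \<in> {J..J + 2} then b else 0"
      have "(if ereal (2 ^ i * l) \<le> side_QR (z, ereal l) R then c i else 0)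
          \<le> A * growth_const * x ^ i + ?u i + ?v i" for i
      proof (cases "ereal (2 ^ i * l) \<le> side_QR (z, ereal l) R")
        case True
        then have "ereal (2 ^ i * l) \<le> ereal (4 * (2 ^ J * l))" using R by (rule order_trans)
        then have "(2::real) ^ i \<le> 2 ^ (J + 2)" using l by (simp add: power_add)
        then have i: "i \<le> J + 2" by (simp only: power_increasing_iff)
        have nn: "0 \<le> A * growth_const * x ^ i" "0 \<le> ?u i" "0 \<le> ?v i" using A growth_const_pos x b0 by auto
        \<comment> \<open>Summand \<open>i\<close> contains the measure of dilate
          \<open>Suc i\<close>, which shifts the ranges by one: decay while
          \<open>Suc i < j\<close>, increase up to \<open>J - 1\<close>, then the three indices left
          by the side bound \<open>4 * (2 ^ J * l)\<close>.\<close>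
        consider "Suc i < j" | "j \<le> Suc i" "i < J" | "J \<le> i" using \<open>j \<le> J\<close> by linarith
        then have "c i \<le> A * growth_const * x ^ i \<or> c i \<le> ?u i \<or> c i \<le> ?v i"
        proof cases
          case 1 then show ?thesis using lower j(2) by blast
        next
          case 2 then show ?thesis using upper by simp
        next
          case 3 then show ?thesis using i cb by simp
        qed
        then show ?thesis unfolding if_P[OF True] using nn by linarith
      qed (use A growth_const_pos x b0 in simp)
      then have "(\<Sum>i<m. if ereal (2 ^ i * l) \<le> side_QR (z, ereal l) R then c i else 0)
          \<le> (\<Sum>i<m. A * growth_const * x ^ i + ?u i + ?v i)" by (rule sum_mono)
      also have "\<dots> = (\<Sum>i<m. A * growth_const * x ^ i) + (\<Sum>i<m. ?u i) + (\<Sum>i<m. ?v i)"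
        by (simp add: sum.distrib)
      also have "(\<Sum>i<m. ?u i) \<le> (\<Sum>i<J. b * (1 / 2) ^ (J - Suc i))"
        using b0 by (subst sum.inter_filter[symmetric]) (auto intro!: sum_mono2)
      also have "\<dots> = b * (\<Sum>i<J. (1 / 2) ^ i)"
        using sum.nat_diff_reindex[of "\<lambda>i. (1 / 2 :: real) ^ i" J] by (simp flip: sum_distrib_left)
      also have "\<dots> \<le> b * 2" using sum_geometric_le[of "1 / 2" J] b0 by (intro mult_left_mono) auto
      also have "(\<Sum>i<m. ?v i) = (\<Sum>i\<in>{..<m} \<inter> {J..J + 2}. b)"
        by (rule sum.inter_restrict[symmetric]) simp
      also have "\<dots> \<le> (\<Sum>i\<in>{J..J + 2}. b)"
        using b0 by (intro sum_mono2) simp_all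
      also have "\<dots> = 3 * b" by simp
      finally show "(\<Sum>i<m. if ereal (2 ^ i * l) \<le> side_QR (z, ereal l) R
          then measure M (cube_set (z, ereal (2 ^ Suc i * l))) * (2 ^ i * l) powr (- n) else 0)
        \<le> A * growth_const / (1 - x) + 5 * b" using geo[of m] unfolding c_def \<phi>_def by linarith
    qed
    moreover have "1 + (A * growth_const / (1 - x) + 5 * b) = Kqr_bound A" by (simp add: Kqr_bound_def b_def x_def)
    moreover have "A * \<phi> 0 \<le> \<phi> J"
      using j(1) J(2) l measure_cube_mono[of "2 ^ j * l" "2 ^ J * l" z] by (simp add: \<phi>_def)
    ultimately show ?thesis
      using l J(1) by (intro that(2)[of "2 ^ J * l"]) (auto simp: \<phi>_def)
  qed
qed

section \<open>Comparison of the Morrey and Campanato norms\<close>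

lemma doubling_Qmu: "doubling M Q \<Longrightarrow> Q \<in> Qmu M"
  by (simp add: doubling_def)

lemma Kqr_ge_1: "1 \<le> Kqr M n Q R"
  by (simp add: Kqr_def)

text \<open>Local integrability makes the truncations to balls measurable, and \<open>f\<close> is
  their pointwise limit.\<close>

lemma borel_measurable_Cpq:
  assumes "f \<in> Cpq M n p q"
  shows "f \<in> borel_measurable M"
proof (rule borel_measurable_LIMSEQ_real)
  fix k :: nat
  have "set_integrable M (cball 0 (real k)) f"
    using assms by (simp add: Cpq_def loc_integrable_def)
  then show "(\<lambda>x. indicator (cball 0 (real k)) x *\<^sub>R f x) \<in> borel_measurable M"
    unfolding set_integrable_def by (rule borel_measurable_integrable)
next
  fix x :: "real^'d"
  obtain K where K: "norm x \<le> real K" using real_arch_simple by blast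
  have "\<forall>\<^sub>F k in sequentially. indicator (cball 0 (real k)) x *\<^sub>R f x = f x"
    using eventually_ge_at_top[of K] by eventually_elim (use K in auto)
  then show "(\<lambda>k. indicator (cball 0 (real k)) x *\<^sub>R f x) \<longlonglongrightarrow> f x"
    by (rule tendsto_eventually)
qed

text \<open>The common shape of the local terms of both norms: \<open>F\<close> is the sequence norm
  of \<open>f j x\<close> in the Morrey case and of \<open>f j x\<close> minus a mean in the
  Campanato case. Values in \<open>ennreal\<close> admit divergent sequence norms.\<close>

definition weighted_Lq :: "real \<Rightarrow> real \<Rightarrow> 'd cube \<Rightarrow> (real^'d \<Rightarrow> ennreal) \<Rightarrow> ennreal" where
  "weighted_Lq p q Q F = ennreal (measure M (cube_set (dil 2 Q)) powr (1/p - 1/q)) *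
     epowr (\<integral>\<^sup>+x\<in>cube_set Q. epowr (F x) q \<partial>M) (1/q)"

lemma weighted_Lq_add_le:
  assumes q: "q \<ge> 1" and r: "r \<ge> 1"
    and [measurable]: "\<And>j. g j \<in> borel_measurable M" "\<And>j. h j \<in> borel_measurable M"
  shows "weighted_Lq p q Q (\<lambda>x. lr_norm r (\<lambda>j. g j x + h j x))
    \<le> 16 * (weighted_Lq p q Q (\<lambda>x. lr_norm r (\<lambda>j. g j x)) + weighted_Lq p q Q (\<lambda>x. lr_norm r (\<lambda>j. h j x)))"
proof -
  define G where "G x = lr_norm r (\<lambda>j. g j x)" for x
  define H where "H x = lr_norm r (\<lambda>j. h j x)" for x
  define J where "J F = (\<integral>\<^sup>+x\<in>cube_set Q. epowr (F x) q \<partial>M)" for F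
  have [measurable]: "G \<in> borel_measurable M" "H \<in> borel_measurable M"
    using r unfolding G_def H_def by (intro borel_measurable_lr_norm; simp)+
  have pointwise: "epowr (lr_norm r (\<lambda>j. g j x + h j x)) q \<le> ennreal (8 powr q) * (epowr (G x) q + epowr (H x) q)" for x
  proof -
    have "epowr (lr_norm r (\<lambda>j. g j x + h j x)) q \<le> epowr (ennreal 4 * (G x + H x)) q"
      using q lr_norm_add_le[OF r] by (intro epowr_mono) (auto simp: G_def H_def)
    also have "\<dots> = ennreal (4 powr q) * epowr (G x + H x) q" by (rule epowr_cmult) simp
    also have "\<dots> \<le> ennreal (4 powr q) * (ennreal (2 powr q) * (epowr (G x) q + epowr (H x) q))"
      using q by (intro mult_left_mono epowr_add_le) auto
    also have "\<dots> = ennreal (8 powr q) * (epowr (G x) q + epowr (H x) q)"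
      by (simp add: mult.assoc[symmetric] flip: ennreal_mult powr_mult)
    finally show ?thesis .
  qed
  have "J (\<lambda>x. lr_norm r (\<lambda>j. g j x + h j x))
      \<le> (\<integral>\<^sup>+x. ennreal (8 powr q) * (epowr (G x) q * indicator (cube_set Q) x
          + epowr (H x) q * indicator (cube_set Q) x) \<partial>M)"
    unfolding J_def using pointwise by (intro nn_integral_mono) (auto split: split_indicator)
  also have "\<dots> = ennreal (8 powr q) * (J G + J H)"
    by (simp add: nn_integral_cmult nn_integral_add J_def)
  finally have "epowr (J (\<lambda>x. lr_norm r (\<lambda>j. g j x + h j x))) (1 / q)
      \<le> epowr (ennreal (8 powr q) * (J G + J H)) (1 / q)"
    using q by (intro epowr_mono) auto
  also have "\<dots> = ennreal 8 * epowr (J G + J H) (1 / q)"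
    using q by (subst epowr_cmult) (auto simp: powr_powr)
  also have "\<dots> \<le> ennreal 8 * (ennreal (2 powr (1 / q)) * (epowr (J G) (1 / q) + epowr (J H) (1 / q)))"
    using q by (intro mult_left_mono epowr_add_le) auto
  also have "\<dots> \<le> ennreal 8 * (ennreal 2 * (epowr (J G) (1 / q) + epowr (J H) (1 / q)))"
    using q powr_mono[of "1 / q" 1 2] by (intro mult_left_mono mult_right_mono ennreal_leI) auto
  \<comment> \<open>Of the 16, a factor 4 stems from the sequence norm and a factor 2 from each of
    the powers \<open>q\<close> and \<open>1 / q\<close>.\<close>
  also have "\<dots> = 16 * (epowr (J G) (1 / q) + epowr (J H) (1 / q))"
    by (simp add: mult.assoc[symmetric] flip: ennreal_mult)
  finally have "weighted_Lq p q Q (\<lambda>x. lr_norm r (\<lambda>j. g j x + h j x))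
      \<le> ennreal (measure M (cube_set (dil 2 Q)) powr (1/p - 1/q)) * (16 * (epowr (J G) (1 / q) + epowr (J H) (1 / q)))"
    unfolding weighted_Lq_def J_def by (intro mult_left_mono) auto
  also have "\<dots> = 16 * (weighted_Lq p q Q G + weighted_Lq p q Q H)"
    unfolding weighted_Lq_def J_def by (simp add: distrib_left mult.left_commute)
  finally show ?thesis unfolding G_def H_def .
qed

text \<open>The exponents \<open>1 / p - 1 / q\<close> and \<open>- 1 / p\<close> are not positive,
  so replacing the larger measures by that of \<open>Q\<close> only increases the bound; together
  with \<open>1 / q\<close> the exponents then sum to 0. In this way bounds for means over
  \<open>dstar M Q\<close> enter the local terms.\<close>

lemma weighted_Lq_const_le:
  assumes Q: "Q \<in> Qmu M" and pq: "1 \<le> q" "q \<le> p" and B: "0 \<le> B"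
    and c: "c \<le> ennreal (B * measure M (cube_set (dstar M Q)) powr (- 1 / p)) * X"
  shows "weighted_Lq p q Q (\<lambda>x. c) \<le> ennreal B * X"
proof -
  define w w2 w' where "w = measure M (cube_set Q)" and "w2 = measure M (cube_set (dil 2 Q))"
    and "w' = measure M (cube_set (dstar M Q))"
  have w: "0 < w" using emeasure_Qmu[OF Q] by (simp add: w_def)
  have w2: "w \<le> w2" unfolding w_def w2_def using dil_Qmu[OF Q] by (intro measure_mono_Qmu) auto
  have w': "w \<le> w'" unfolding w_def w'_def
    using doubling_dstar[OF Q] by (intro measure_mono_Qmu) (auto simp: doubling_Qmu)
  have "epowr (\<integral>\<^sup>+x\<in>cube_set Q. epowr c q \<partial>M) (1/q) = epowr (ennreal w * epowr c q) (1 / q)"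
    using emeasure_Qmu[OF Q] by (simp add: nn_integral_cmult_indicator w_def mult.commute)
  also have "\<dots> = ennreal (w powr (1 / q)) * c"
    using w pq by (simp add: epowr_cmult epowr_epowr epowr_one)
  finally have "weighted_Lq p q Q (\<lambda>x. c) = ennreal (w2 powr (1/p - 1/q)) * (ennreal (w powr (1 / q)) * c)"
    by (simp add: weighted_Lq_def w2_def)
  also have "\<dots> \<le> ennreal (w2 powr (1/p - 1/q)) * (ennreal (w powr (1 / q)) * (ennreal (B * w' powr (- 1 / p)) * X))"
    using c by (intro mult_left_mono) (auto simp: w'_def)
  also have "\<dots> = ennreal (w2 powr (1/p - 1/q) * (w powr (1 / q) * (B * w' powr (- 1 / p)))) * X"
    using B by (simp add: ennreal_mult mult.assoc)
  also have "\<dots> \<le> ennreal (w powr (1/p - 1/q) * (w powr (1 / q) * (B * w powr (- 1 / p)))) * X"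
    using pq w w2 w' B
    by (intro mult_right_mono ennreal_leI mult_mono mult_left_mono powr_mono2') (auto simp: frac_le)
  also have "w powr (1/p - 1/q) * (w powr (1 / q) * (B * w powr (- 1 / p))) = B * w powr ((1/p - 1/q) + (1/q + (- 1/p)))"
    by (simp only: powr_add mult_ac)
  also have "\<dots> = B" using w by simp
  finally show ?thesis .
qed

lemma weighted_Lq_le_Mpq: "Q \<in> Qmu M \<Longrightarrow> weighted_Lq p q Q (\<lambda>x. lr_norm r (\<lambda>j. f j x)) \<le> Mpq_lr_norm M p q r f"
  unfolding Mpq_lr_norm_def weighted_Lq_def by (rule SUP_upper)

lemma weighted_Lq_le_Cpq:
  "Q \<in> Qmu M \<Longrightarrow> weighted_Lq p q Q (\<lambda>x. lr_norm r (\<lambda>j. f j x - mean M (dstar M Q) (f j))) \<le> Cpq_lr_norm M n p q r f"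
  unfolding Cpq_lr_norm_def weighted_Lq_def by (rule order_trans[OF SUP_upper add_increasing2]) auto

lemma mean_diff_le_Cpq:
  assumes Q: "doubling M Q" and R: "doubling M R" and QR: "cube_set Q \<subseteq> cube_set R"
    and K: "Kqr M n Q R \<le> ennreal K" "0 \<le> K"
  shows "lr_norm r (\<lambda>j. mean M Q (f j) - mean M R (f j))
    \<le> ennreal (K * measure M (cube_set Q) powr (- 1 / p)) * Cpq_lr_norm M n p q r f"
proof -
  define w where "w = measure M (cube_set Q)"
  have w: "0 < w" using emeasure_Qmu doubling_Qmu[OF Q] by (simp add: w_def)
  define Y where "Y = lr_norm r (\<lambda>j. mean M Q (f j) - mean M R (f j))"
  define k where "k = Kqr M n Q R"
  \<comment> \<open>Cancelling the coefficient in \<open>ennreal\<close> requires that it be neither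
    0 nor infinite.\<close>
  have k: "k \<noteq> 0" "k < top"
    using K Kqr_ge_1[of Q R] by (auto simp: k_def intro: le_less_trans[of _ "ennreal K"])
  have "ennreal (w powr (1 / p)) * Y / k \<le> Cpq_lr_norm M n p q r f"
    unfolding Cpq_lr_norm_def Y_def w_def k_def using Q R QR
    by (intro add_increasing SUP_upper2[of "(Q, R)"]) auto
  then have "ennreal (w powr (1 / p)) * Y / k * k \<le> Cpq_lr_norm M n p q r f * ennreal K"
    using K by (intro mult_mono) (auto simp: k_def)
  then have "ennreal (w powr (1 / p)) * Y \<le> ennreal K * Cpq_lr_norm M n p q r f"
    unfolding ennreal_divide_times ennreal_divide_self[OF k] by (simp add: mult.commute)
  then have "Y \<le> ennreal (1 / w powr (1 / p)) * (ennreal K * Cpq_lr_norm M n p q r f)"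
    using w by (intro le_divide_ennreal) auto
  also have "\<dots> = ennreal (K * w powr (- 1 / p)) * Cpq_lr_norm M n p q r f"
    using K(2) by (simp add: powr_minus_divide[symmetric] ennreal_mult mult_ac)
  finally show ?thesis by (simp add: Y_def w_def)
qed

text \<open>Along the chain of cubes the measures grow by the factor \<open>8 powr p\<close>, so the weights
  \<open>\<mu>(Q) powr (- 1 / p)\<close> shrink by \<open>8\<close>, which beats the constant \<open>4\<close> of the quasi-triangle inequality.\<close>
lemma mean_diff_telescope:
  fixes R :: "'d cube"
  assumes p: "p > 0" and r: "r \<ge> 1" and R: "doubling M R"
    and side: "\<And>t s. 0 < t \<Longrightarrow> \<not> cube_set (z, ereal t) \<subseteq> cube_set R \<Longrightarrow> side_QR (z, s) R \<le> ereal (4 * t)"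
  shows "doubling M (z, ereal l) \<Longrightarrow> cube_set (z, ereal l) \<subseteq> cube_set R
    \<Longrightarrow> measure M (cube_set R) < (8 powr p) ^ m * measure M (cube_set (z, ereal l))
    \<Longrightarrow> lr_norm r (\<lambda>j. mean M (z, ereal l) (f j) - mean M R (f j))
      \<le> ennreal (8 * Kqr_bound (8 powr p) * measure M (cube_set (z, ereal l)) powr (- 1 / p)) * Cpq_lr_norm M n p q r f"
\<comment> \<open>\<open>m\<close> bounds the number of remaining links: each multiplies the measure
  by at least \<open>8 powr p\<close>, and \<open>R\<close> has finite measure. For
  \<open>m = 0\<close> the cube would have larger measure than \<open>R\<close>, which contains
  it.\<close>
proof (induction m arbitrary: l)
  case 0
  have "measure M (cube_set (z, ereal l)) \<le> measure M (cube_set R)"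
    using 0 R by (intro measure_mono_Qmu) (auto simp: doubling_Qmu)
  with 0 show ?case by simp
next
  case (Suc m)
  define A where "A = 8 powr p"
  define N where "N = Cpq_lr_norm M n p q r f"
  define w where "w l = measure M (cube_set (z, ereal l))" for l
  define v where "v = w l powr (- 1 / p)"
  have A: "A \<ge> 1" using p by (simp add: A_def ge_one_powr_ge_zero)
  have K: "Kqr_bound A > 0" using A by (intro Kqr_bound_pos) simp
  have Q: "(z, ereal l) \<in> Qmu M" using Suc.prems(1) by (rule doubling_Qmu)
  then have l: "0 < l" and w0: "0 < w l" by (auto simp: Qmu_ereal_iff w_def)
  have direct: ?case if "Kqr M n (z, ereal l) R \<le> ennreal (Kqr_bound A)"
  proof -
    have "lr_norm r (\<lambda>j. mean M (z, ereal l) (f j) - mean M R (f j)) \<le> ennreal (Kqr_bound A * v) * N"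
      unfolding v_def w_def N_def using that K Suc.prems R by (intro mean_diff_le_Cpq) auto
    also have "\<dots> \<le> ennreal (8 * Kqr_bound A * v) * N"
      using K by (intro mult_right_mono ennreal_leI) (auto simp: v_def)
    finally show ?thesis by (simp add: A_def v_def w_def N_def)
  qed
  from Q A show ?case
  proof (cases rule: next_doubling_cube)
    case 1
    then show ?thesis by (rule direct)
  next
    case (2 t)
    show ?thesis
    proof (cases "cube_set (z, ereal t) \<subseteq> cube_set R")
      \<comment> \<open>The next cube sticks out of \<open>R\<close>. By \<open>side\<close>, the
        concentric enlargement reaching \<open>R\<close> has side at most \<open>4 * t\<close>,
        within the range where the coefficient is bounded.\<close>
      case False
      then show ?thesis using 2 side[of t] l by (intro direct) auto
    next
      case True
      have "Kqr M n (z, ereal l) (z, ereal t) \<le> ennreal (Kqr_bound A)"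
        using 2(1) l cube_set_mono[of t "4 * t" z] by (intro 2(4) side_QR_le) auto
      then have 3: "lr_norm r (\<lambda>j. mean M (z, ereal l) (f j) - mean M (z, ereal t) (f j)) \<le> ennreal (Kqr_bound A * v) * N"
        unfolding v_def w_def N_def using K Suc.prems 2 by (intro mean_diff_le_Cpq cube_set_mono) auto
      have "measure M (cube_set R) < A ^ m * (A * w l)"
        using Suc.prems(3) by (simp add: A_def w_def mult_ac)
      also have "\<dots> \<le> A ^ m * w t"
        using 2(3) A by (intro mult_left_mono) (auto simp: w_def)
      finally have "lr_norm r (\<lambda>j. mean M (z, ereal t) (f j) - mean M R (f j))
          \<le> ennreal (8 * Kqr_bound A * w t powr (- 1 / p)) * N"
        using Suc.IH[OF 2(2) True] by (simp add: A_def w_def N_def)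
      also have "\<dots> \<le> ennreal (Kqr_bound A * v) * N"
      proof (intro mult_right_mono ennreal_leI)
        have "w t powr (- 1 / p) \<le> (A * w l) powr (- 1 / p)"
          using 2(3) p A w0 by (intro powr_mono2') (auto simp: w_def)
        also have "\<dots> = v / 8"
          using p w0 by (simp add: A_def powr_mult powr_powr v_def powr_minus)
        finally show "8 * Kqr_bound A * w t powr (- 1 / p) \<le> Kqr_bound A * v" using K by simp
      qed simp
      finally have 4: "lr_norm r (\<lambda>j. mean M (z, ereal t) (f j) - mean M R (f j)) \<le> ennreal (Kqr_bound A * v) * N" .
      \<comment> \<open>The constant reproduces itself: two terms \<open>Kqr_bound A * v\<close>
        under the quasi-triangle factor 4 give the 8 of the claim.\<close>
      have "lr_norm r (\<lambda>j. mean M (z, ereal l) (f j) - mean M R (f j))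
          \<le> 4 * (lr_norm r (\<lambda>j. mean M (z, ereal l) (f j) - mean M (z, ereal t) (f j))
              + lr_norm r (\<lambda>j. mean M (z, ereal t) (f j) - mean M R (f j)))"
        using lr_norm_add_le[OF r, of "\<lambda>j. mean M (z, ereal l) (f j) - mean M (z, ereal t) (f j)"
            "\<lambda>j. mean M (z, ereal t) (f j) - mean M R (f j)"] by simp
      also have "\<dots> \<le> 4 * (ennreal (Kqr_bound A * v) * N + ennreal (Kqr_bound A * v) * N)"
        using 3 4 by (intro mult_left_mono add_mono) auto
      also have "\<dots> = ennreal 8 * (ennreal (Kqr_bound A * v) * N)"
        by (simp add: mult_2[symmetric] mult.assoc[symmetric])
      also have "\<dots> = ennreal (8 * Kqr_bound A * v) * N"
        using K by (simp add: ennreal_mult v_def mult.assoc)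
      finally show ?thesis by (simp add: A_def v_def w_def N_def)
    qed
  qed
qed

text \<open>Minkowski's and Hoelder's inequalities cost a factor 2 each. The Morrey norm weighs by
  the measure of \<open>dil 2 R\<close> to a power that is not positive, and doubling is what
  permits the return to the measure of \<open>R\<close>.\<close>

lemma mean_le_Mpq:
  assumes R: "doubling M R" and pq: "1 \<le> q" "q \<le> p" and r: "1 < r" and f: "\<And>j. f j \<in> Cpq M n p q"
  shows "lr_norm r (\<lambda>j. mean M R (f j))
    \<le> ennreal (4 * 2 ^ (CARD('d) + 1) * measure M (cube_set R) powr (- 1 / p)) * Mpq_lr_norm M p q r f"
proof -
  define D :: real where "D = 2 ^ (CARD('d) + 1)"
  define w w2 where "w = measure M (cube_set R)" and "w2 = measure M (cube_set (dil 2 R))"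
  define F where "F x = lr_norm r (\<lambda>j. f j x)" for x
  have RQ: "R \<in> Qmu M" using R by (rule doubling_Qmu)
  have w: "0 < w" using emeasure_Qmu[OF RQ] by (simp add: w_def)
  have w2: "0 < w2" using emeasure_Qmu[OF dil_Qmu(1)[OF RQ, of 2]] by (simp add: w2_def)
  have ww: "w2 \<le> D * w" using R RQ by (simp add: doubling_iff w_def w2_def D_def)
  have D: "1 \<le> D" unfolding D_def by (rule one_le_power) simp
  have [measurable]: "f j \<in> borel_measurable M" for j using f by (rule borel_measurable_Cpq)
  have [measurable]: "F \<in> borel_measurable M"
    unfolding F_def using r by (intro borel_measurable_lr_norm) auto
  have int: "integrable M (\<lambda>x. indicator (cube_set R) x *\<^sub>R f j x)" for j
    using f[of j] RQ by (auto simp: Cpq_def set_integrable_def)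
  define X where "X = epowr (\<integral>\<^sup>+x\<in>cube_set R. epowr (F x) q \<partial>M) (1 / q)"
  have "ennreal (w2 powr (1/p - 1/q)) * X \<le> Mpq_lr_norm M p q r f"
    using weighted_Lq_le_Mpq[OF RQ, of p q r f] by (simp add: weighted_Lq_def X_def w2_def F_def)
  then have "X \<le> ennreal (1 / w2 powr (1/p - 1/q)) * Mpq_lr_norm M p q r f"
    using w2 by (intro le_divide_ennreal) auto
  also have "1 / w2 powr (1/p - 1/q) = w2 powr (1/q - 1/p)"
    using powr_minus_divide[of w2 "1/p - 1/q"] by simp
  also have "ennreal (w2 powr (1/q - 1/p)) * Mpq_lr_norm M p q r f \<le> ennreal (D * w powr (1/q - 1/p)) * Mpq_lr_norm M p q r f"
  proof (intro mult_right_mono ennreal_leI)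
    \<comment> \<open>With the exponent in the unit interval, the power of the doubling constant
      \<open>D\<close> is at most \<open>D\<close>.\<close>
    have e: "0 \<le> 1/q - 1/p" "1/q - 1/p \<le> 1"
      using pq by (auto simp: frac_le) (smt (verit) divide_le_eq_1 zero_le_divide_1_iff)
    have "w2 powr (1/q - 1/p) \<le> (D * w) powr (1/q - 1/p)"
      using ww w2 e by (intro powr_mono2) auto
    also have "\<dots> = D powr (1/q - 1/p) * w powr (1/q - 1/p)"
      using D w by (simp add: powr_mult)
    also have "\<dots> \<le> D * w powr (1/q - 1/p)"
      using powr_mono[OF e(2), of D] D by (intro mult_right_mono) auto
    finally show "w2 powr (1/q - 1/p) \<le> D * w powr (1/q - 1/p)" .
  qed simp
  finally have X: "X \<le> ennreal (D * w powr (1/q - 1/p)) * Mpq_lr_norm M p q r f" .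
  have "lr_norm r (\<lambda>j. mean M R (f j)) = lr_norm r (\<lambda>j. (1 / w) * (\<integral>x. indicator (cube_set R) x *\<^sub>R f j x \<partial>M))"
    by (simp add: mean_def set_lebesgue_integral_def w_def)
  also have "\<dots> = ennreal (1 / w) * lr_norm r (\<lambda>j. \<integral>x. indicator (cube_set R) x *\<^sub>R f j x \<partial>M)"
    using w r by (intro lr_norm_cmult) auto
  also have "\<dots> \<le> ennreal (1 / w) * (2 * (\<integral>\<^sup>+x. lr_norm r (\<lambda>j. indicator (cube_set R) x *\<^sub>R f j x) \<partial>M))"
    by (intro mult_left_mono lr_norm_integral_le[OF r int]) simp
  also have "(\<lambda>x. lr_norm r (\<lambda>j. indicator (cube_set R) x *\<^sub>R f j x)) = (\<lambda>x. F x * indicator (cube_set R) x)"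
    by (auto simp: F_def lr_norm_zero split: split_indicator)
  also have "ennreal (1 / w) * (2 * (\<integral>\<^sup>+x\<in>cube_set R. F x \<partial>M))
      \<le> ennreal (1 / w) * (2 * (ennreal (2 * w powr (1 - 1 / q)) * X))"
    unfolding X_def using emeasure_Qmu[OF RQ] w
    by (intro mult_left_mono nn_integral_le_epowr pq(1)) (auto simp: w_def)
  also have "\<dots> \<le> ennreal (1 / w) * (2 * (ennreal (2 * w powr (1 - 1 / q)) * (ennreal (D * w powr (1/q - 1/p)) * Mpq_lr_norm M p q r f)))"
    by (intro mult_left_mono X) auto
  also have "\<dots> = ennreal (1 / w * (2 * (2 * w powr (1 - 1 / q) * (D * w powr (1/q - 1/p))))) * Mpq_lr_norm M p q r f"
    using w D by (simp add: mult.assoc[symmetric] flip: ennreal_mult ennreal_numeral)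
  also have "1 / w * (2 * (2 * w powr (1 - 1 / q) * (D * w powr (1/q - 1/p)))) = 4 * D * (w powr (- 1) * w powr (1 - 1 / q) * w powr (1/q - 1/p))"
    using w by (simp add: powr_minus_divide)
  also have "w powr (- 1) * w powr (1 - 1 / q) * w powr (1/q - 1/p) = w powr (- 1 / p)"
  proof -
    have "- 1 + (1 - 1 / q) + (1/q - 1/p) = - 1 / p" by simp
    then show ?thesis by (metis powr_add)
  qed
  finally show ?thesis by (simp add: D_def w_def)
qed

section \<open>Exhaustion of the space by the cubes I_k\<close>

lemma eventually_absorb:
  fixes I :: "nat \<Rightarrow> 'd cube"
  assumes Qmu: "\<And>k. I k \<in> Qmu M" and centre: "\<And>k. fst (I k) = c"
    and inc: "\<And>k. cube_set (I k) \<subseteq> cube_set (I (Suc k))"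
    and cover: "(\<Union>k. cube_set (I k)) = UNIV" and l: "0 < l"
  shows "\<forall>\<^sub>F k in sequentially. cube_set (z, ereal l) \<subseteq> cube_set (I k) \<and>
    (\<forall>t>0. \<forall>s. \<not> cube_set (z, ereal t) \<subseteq> cube_set (I k) \<longrightarrow> side_QR (z, s) (I k) \<le> ereal (4 * t))"
proof -
  define \<rho> where "\<rho> = norm (z - c) + l"
  have zc: "\<bar>z$i - c$i\<bar> \<le> \<rho> - l" for i
    using component_le_norm_cart[of "z - c" i] by (simp add: \<rho>_def)
  have \<rho>: "\<rho> \<ge> l" by (simp add: \<rho>_def)
  \<comment> \<open>A cube centred at \<open>c\<close> that contains this diagonal point has side at
    least \<open>4 * \<rho>\<close>. As \<open>\<rho>\<close> exceeds the distance of the centres,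
    the offset of \<open>z\<close> from \<open>c\<close> is small compared with such a cube.\<close>
  obtain k0 where k0: "(\<chi> i. c$i + 2 * \<rho>) \<in> cube_set (I k0)" using cover by blast
  show ?thesis
    using eventually_ge_at_top[of k0]
  proof eventually_elim
    case (elim k)
    have y: "(\<chi> i. c$i + 2 * \<rho>) \<in> cube_set (I k)"
      using lift_Suc_mono_le[of "\<lambda>k. cube_set (I k)", OF inc elim] k0 by blast
    show ?case
      using Qmu[of k]
    proof (cases rule: Qmu_cases)
      case (1 c' L)
      then have IL: "I k = (c, ereal L)" using centre[of k] by simp
      then have L: "4 * \<rho> \<le> L" using y \<rho> l by (simp add: cube_set_ereal)
      have "cube_set (z, ereal l) \<subseteq> cube_set (I k)"
        unfolding IL cube_set_ereal
      proof (intro subsetI CollectI allI)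
        fix y i assume "y \<in> {y. \<forall>i. \<bar>y$i - z$i\<bar> \<le> l / 2}"
        then have "\<bar>y$i - z$i\<bar> \<le> l / 2" by blast
        then show "\<bar>y$i - c$i\<bar> \<le> L / 2" using zc[of i] L \<rho> l by linarith
      qed
      moreover have "side_QR (z, s) (I k) \<le> ereal (4 * t)"
        if t: "t > 0" and sub: "\<not> cube_set (z, ereal t) \<subseteq> cube_set (I k)" for t s
      proof (rule side_QR_le)
        obtain y where y: "y \<in> cube_set (z, ereal t)" "y \<notin> cube_set (c, ereal L)" using sub IL by auto
        then obtain i where "L / 2 < \<bar>y$i - c$i\<bar>" by (auto simp: cube_set_ereal not_le)
        moreover have "\<bar>y$i - z$i\<bar> \<le> t / 2" using y by (simp add: cube_set_ereal)
        \<comment> \<open>The point outside gives \<open>L / 2 < \<rho> + t / 2\<close>, and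
          \<open>\<rho> \<le> L / 4\<close>. Then also \<open>L / 2 + \<rho> < 2 * t\<close>, so the
          dilate by 4 contains \<open>I k\<close>.\<close>
        ultimately have Lt: "L < 2 * t" using zc[of i] L \<rho> l by linarith
        show "cube_set (I k) \<subseteq> cube_set (z, ereal (4 * t))"
          unfolding IL cube_set_ereal
        proof (intro subsetI CollectI allI)
          fix y i assume "y \<in> {y. \<forall>i. \<bar>y$i - c$i\<bar> \<le> L / 2}"
          then have "\<bar>y$i - c$i\<bar> \<le> L / 2" by blast
          then show "\<bar>y$i - z$i\<bar> \<le> 4 * t / 2" using zc[of i] L Lt \<rho> l by linarith
        qed
      qed (use t in simp)
      ultimately show ?thesis by blast
    next
      case (2 c')
      then show ?thesis by (simp add: cube_set_infinity)
    qed
  qed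
qed

text \<open>A cube of infinite side lies in \<open>Qmu M\<close> only if \<open>M\<close> is finite;
  \<open>f\<close> is then integrable on the whole space and dominated convergence applies. No chain
  starts at such a cube, so its mean is found directly as a limit.\<close>

lemma mean_infinity_limit:
  assumes f: "f \<in> Cpq M n p q" and inf: "(z, \<infinity>) \<in> Qmu M"
    and inc: "\<And>k. cube_set (I k) \<subseteq> cube_set (I (Suc k))"
    and cover: "(\<Union>k. cube_set (I k)) = UNIV"
  shows "(\<lambda>k. mean M (I k) f) \<longlonglongrightarrow> mean M (z, \<infinity>) f"
proof -
  have incseq: "incseq (\<lambda>k. cube_set (I k))" using inc by (rule incseq_SucI)
  have fin: "emeasure M UNIV < \<infinity>" using inf by (simp add: Qmu_def)
  have "set_integrable M UNIV f" using f inf by (force simp: Cpq_def cube_set_infinity)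
  then have "(\<lambda>k. LINT x:cube_set (I k)|M. f x) \<longlonglongrightarrow> (LINT x:UNIV|M. f x)"
    using set_integral_cont_up[of "\<lambda>k. cube_set (I k)" M f] incseq cover by simp
  moreover have "(\<lambda>k. measure M (cube_set (I k))) \<longlonglongrightarrow> measure M UNIV"
    using Lim_measure_incseq[of "\<lambda>k. cube_set (I k)" M] incseq cover fin cube_set_sets by (auto simp: image_subset_iff)
  moreover have "measure M UNIV \<noteq> 0" using emeasure_Qmu(2)[OF inf] by (simp add: cube_set_infinity)
  ultimately show ?thesis unfolding mean_def cube_set_infinity by (rule tendsto_divide)
qed

text \<open>The telescoping bound for \<open>Q\<close> and \<open>I k\<close> does not depend on
  \<open>k\<close>, so the limit in \<open>k\<close> removes the mean over \<open>I k\<close>. If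
  \<open>Q\<close> is the whole space, its mean is the limit of those over \<open>I k\<close>, hence
  0.\<close>

lemma mean_le_Cpq:
  fixes I :: "nat \<Rightarrow> 'd cube"
  assumes p: "p > 0" and r: "r \<ge> 1" and f: "\<And>j. f j \<in> Cpq M n p q"
    and I: "\<And>k. doubling M (I k)" "\<And>k. fst (I k) = fst (I 0)"
    and inc: "\<And>k. cube_set (I k) \<subseteq> cube_set (I (Suc k))"
    and cover: "(\<Union>k. cube_set (I k)) = UNIV"
    and lim: "\<And>j. (\<lambda>k. mean M (I k) (f j)) \<longlonglongrightarrow> 0"
    and Q: "doubling M Q"
  shows "lr_norm r (\<lambda>j. mean M Q (f j))
    \<le> ennreal (8 * Kqr_bound (8 powr p) * measure M (cube_set Q) powr (- 1 / p)) * Cpq_lr_norm M n p q r f"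
  using doubling_Qmu[OF Q]
proof (cases rule: Qmu_cases)
  case (2 z)
  have "mean M Q (f j) = 0" for j
    using mean_infinity_limit[OF f _ inc cover, where z = z] lim[of j] doubling_Qmu[OF Q] 2(1) LIMSEQ_unique
    by blast
  then show ?thesis by (simp add: lr_norm_zero)
next
  case (1 z l)
  show ?thesis
  proof (rule lr_norm_le_of_tendsto)
    show "(\<lambda>k. mean M Q (f j) - mean M (I k) (f j)) \<longlonglongrightarrow> mean M Q (f j)" for j
      using tendsto_diff[OF tendsto_const lim[of j], of "mean M Q (f j)"] by simp
    have "\<forall>\<^sub>F k in sequentially. cube_set (z, ereal l) \<subseteq> cube_set (I k) \<and>
        (\<forall>t>0. \<forall>s. \<not> cube_set (z, ereal t) \<subseteq> cube_set (I k) \<longrightarrow> side_QR (z, s) (I k) \<le> ereal (4 * t))"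
      using I(1) inc cover 1(2) by (intro eventually_absorb[OF _ I(2)]) (auto intro: doubling_Qmu)
    then show "\<forall>\<^sub>F k in sequentially. lr_norm r (\<lambda>j. mean M Q (f j) - mean M (I k) (f j))
        \<le> ennreal (8 * Kqr_bound (8 powr p) * measure M (cube_set Q) powr (- 1 / p)) * Cpq_lr_norm M n p q r f"
    proof eventually_elim
      case (elim k)
      let ?w = "measure M (cube_set (z, ereal l))"
      have "0 < ?w" using emeasure_Qmu(2) doubling_Qmu[OF Q] 1(1) by blast
      \<comment> \<open>The number \<open>m\<close> of links may grow with \<open>k\<close>, but it
        leaves no trace in the bound.\<close>
      moreover have "1 < 8 powr p" using p by simp
      then obtain m where "measure M (cube_set (I k)) / ?w < (8 powr p) ^ m"
        using real_arch_pow by blast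
      ultimately have "measure M (cube_set (I k)) < (8 powr p) ^ m * ?w"
        by (simp add: field_simps)
      then show ?case
        unfolding 1(1) using Q elim I(1) p r
        by (intro mean_diff_telescope) (auto simp: 1(1))
    qed
  qed (use r in simp)
qed

section \<open>The two inequalities between the norms\<close>

lemma Mpq_le_Cpq:
  fixes I :: "nat \<Rightarrow> 'd cube"
  assumes pq: "1 \<le> q" "q \<le> p" and r: "r \<ge> 1" and f: "\<And>j. f j \<in> Cpq M n p q"
    and I: "\<And>k. doubling M (I k)" "\<And>k. fst (I k) = fst (I 0)"
    and inc: "\<And>k. cube_set (I k) \<subseteq> cube_set (I (Suc k))"
    and cover: "(\<Union>k. cube_set (I k)) = UNIV"
    and lim: "\<And>j. (\<lambda>k. mean M (I k) (f j)) \<longlonglongrightarrow> 0"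
  shows "Mpq_lr_norm M p q r f \<le> ennreal (16 * (1 + 8 * Kqr_bound (8 powr p))) * Cpq_lr_norm M n p q r f"
proof -
  define N where "N = Cpq_lr_norm M n p q r f"
  define B where "B = 8 * Kqr_bound (8 powr p)"
  have B: "0 \<le> B" using Kqr_bound_pos[of "8 powr p"] by (simp add: B_def)
  have [measurable]: "f j \<in> borel_measurable M" for j using f by (rule borel_measurable_Cpq)
  have "weighted_Lq p q Q (\<lambda>x. lr_norm r (\<lambda>j. f j x)) \<le> ennreal (16 * (1 + B)) * N" if Q: "Q \<in> Qmu M" for Q
  proof -
    \<comment> \<open>Separating the mean over \<open>dstar M Q\<close> leaves a term of the
      Campanato norm and a constant sequence; that cube is doubling, so the bound for means applies
      to the constant.\<close>
    have "weighted_Lq p q Q (\<lambda>x. lr_norm r (\<lambda>j. f j x))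
        = weighted_Lq p q Q (\<lambda>x. lr_norm r (\<lambda>j. (f j x - mean M (dstar M Q) (f j)) + mean M (dstar M Q) (f j)))"
      by simp
    also have "\<dots> \<le> 16 * (weighted_Lq p q Q (\<lambda>x. lr_norm r (\<lambda>j. f j x - mean M (dstar M Q) (f j)))
        + weighted_Lq p q Q (\<lambda>x. lr_norm r (\<lambda>j. mean M (dstar M Q) (f j))))"
      using pq r by (intro weighted_Lq_add_le) auto
    also have "\<dots> \<le> 16 * (N + ennreal B * N)"
    proof (intro mult_left_mono add_mono)
      show "weighted_Lq p q Q (\<lambda>x. lr_norm r (\<lambda>j. f j x - mean M (dstar M Q) (f j))) \<le> N"
        unfolding N_def by (rule weighted_Lq_le_Cpq[OF Q])
      show "weighted_Lq p q Q (\<lambda>x. lr_norm r (\<lambda>j. mean M (dstar M Q) (f j))) \<le> ennreal B * N"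
        unfolding N_def B_def using pq
        by (intro weighted_Lq_const_le[OF Q pq] mean_le_Cpq[OF _ r f I inc cover lim doubling_dstar(1)[OF Q]]
            B[unfolded B_def]) simp
    qed simp
    also have "\<dots> = ennreal (16 * (1 + B)) * N"
      using B by (simp add: ennreal_mult ennreal_plus distrib_left distrib_right mult.assoc)
    finally show ?thesis .
  qed
  then have "(SUP Q\<in>Qmu M. weighted_Lq p q Q (\<lambda>x. lr_norm r (\<lambda>j. f j x))) \<le> ennreal (16 * (1 + B)) * N"
    by (rule SUP_least)
  then show ?thesis by (simp add: Mpq_lr_norm_def weighted_Lq_def N_def B_def)
qed

text \<open>Oscillations and differences of means are split into their two parts, and the
  coefficient in the denominator is at least 1. With \<open>B = 4 * 2 ^ (d + 1)\<close> the two
  suprema contribute \<open>16 * (1 + B)\<close> and \<open>8 * B\<close>.\<close>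

lemma Cpq_le_Mpq:
  assumes pq: "1 \<le> q" "q \<le> p" and r: "r > 1" and f: "\<And>j. f j \<in> Cpq M n p q"
  shows "Cpq_lr_norm M n p q r f \<le> ennreal (16 + 96 * 2 ^ (CARD('d) + 1)) * Mpq_lr_norm M p q r f"
proof -
  define N where "N = Mpq_lr_norm M p q r f"
  define B :: real where "B = 4 * 2 ^ (CARD('d) + 1)"
  have B: "0 \<le> B" by (simp add: B_def)
  have [measurable]: "f j \<in> borel_measurable M" for j using f by (rule borel_measurable_Cpq)
  have mean: "lr_norm r (\<lambda>j. mean M R (f j)) \<le> ennreal (B * measure M (cube_set R) powr (- 1 / p)) * N"
    if "doubling M R" for R
    using mean_le_Mpq[OF that pq r f] by (simp add: B_def N_def)
  have 1: "weighted_Lq p q Q (\<lambda>x. lr_norm r (\<lambda>j. f j x - mean M (dstar M Q) (f j))) \<le> ennreal (16 * (1 + B)) * N"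
    if Q: "Q \<in> Qmu M" for Q
  proof -
    have "weighted_Lq p q Q (\<lambda>x. lr_norm r (\<lambda>j. f j x + - mean M (dstar M Q) (f j)))
        \<le> 16 * (weighted_Lq p q Q (\<lambda>x. lr_norm r (\<lambda>j. f j x)) + weighted_Lq p q Q (\<lambda>x. lr_norm r (\<lambda>j. - mean M (dstar M Q) (f j))))"
      using pq r by (intro weighted_Lq_add_le) auto
    also have "\<dots> \<le> 16 * (N + ennreal B * N)"
    proof (intro mult_left_mono add_mono)
      show "weighted_Lq p q Q (\<lambda>x. lr_norm r (\<lambda>j. f j x)) \<le> N"
        unfolding N_def by (rule weighted_Lq_le_Mpq[OF Q])
      show "weighted_Lq p q Q (\<lambda>x. lr_norm r (\<lambda>j. - mean M (dstar M Q) (f j))) \<le> ennreal B * N"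
        unfolding lr_norm_uminus by (intro weighted_Lq_const_le[OF Q pq B] mean doubling_dstar(1)[OF Q])
    qed simp
    also have "\<dots> = ennreal (16 * (1 + B)) * N"
      using B by (simp add: ennreal_mult ennreal_plus distrib_left distrib_right mult.assoc)
    finally show ?thesis by simp
  qed
  have 2: "ennreal (measure M (cube_set Q) powr (1/p)) *
      lr_norm r (\<lambda>j. mean M Q (f j) - mean M R (f j)) / Kqr M n Q R \<le> ennreal (8 * B) * N"
    if Q: "doubling M Q" and R: "doubling M R" and QR: "cube_set Q \<subseteq> cube_set R" for Q R
  proof -
    define w where "w = measure M (cube_set Q)"
    have w: "0 < w" using emeasure_Qmu doubling_Qmu[OF Q] by (simp add: w_def)
    \<comment> \<open>The mean over the larger cube has the smaller weight, so the weight of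
      \<open>Q\<close> serves for both means.\<close>
    have "w \<le> measure M (cube_set R)"
      unfolding w_def using R QR by (intro measure_mono_Qmu doubling_Qmu)
    then have "lr_norm r (\<lambda>j. mean M R (f j)) \<le> ennreal (B * w powr (- 1 / p)) * N"
      using w pq B by (intro order_trans[OF mean[OF R]] mult_right_mono ennreal_leI mult_left_mono powr_mono2') auto
    then have "lr_norm r (\<lambda>j. mean M Q (f j) - mean M R (f j))
        \<le> 4 * (ennreal (B * w powr (- 1 / p)) * N + ennreal (B * w powr (- 1 / p)) * N)"
      using r mean[OF Q] by (intro order_trans[OF lr_norm_diff_le] mult_left_mono add_mono) (auto simp: w_def)
    also have "\<dots> = ennreal (8 * (B * w powr (- 1 / p))) * N"
      using B by (simp add: ennreal_mult mult_2[symmetric] mult.assoc[symmetric])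
    finally have "ennreal (w powr (1 / p)) * lr_norm r (\<lambda>j. mean M Q (f j) - mean M R (f j))
        \<le> ennreal (w powr (1 / p)) * (ennreal (8 * (B * w powr (- 1 / p))) * N)"
      by (intro mult_left_mono) auto
    also have "\<dots> = ennreal (w powr (1 / p) * (8 * (B * w powr (- 1 / p)))) * N"
      using B by (simp add: ennreal_mult mult.assoc)
    also have "w powr (1 / p) * (8 * (B * w powr (- 1 / p))) = 8 * B"
      using w by (simp add: powr_minus)
    also have "ennreal (8 * B) * N \<le> Kqr M n Q R * (ennreal (8 * B) * N)"
      using Kqr_ge_1[of Q R] mult_right_mono[of 1 "Kqr M n Q R" "ennreal (8 * B) * N"] by simp
    finally show ?thesis
      by (intro divide_le_posI_ennreal less_le_trans[OF zero_less_one Kqr_ge_1]) (simp_all add: w_def)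
  qed
  have "Cpq_lr_norm M n p q r f \<le> ennreal (16 * (1 + B)) * N + ennreal (8 * B) * N"
    unfolding Cpq_lr_norm_def
  proof (intro add_mono SUP_least)
    fix Q assume "Q \<in> Qmu M"
    from 1[OF this] show "ennreal (measure M (cube_set (dil 2 Q)) powr (1/p - 1/q)) *
         epowr (\<integral>\<^sup>+x\<in>cube_set Q.
            epowr (lr_norm r (\<lambda>j. f j x - mean M (dstar M Q) (f j))) q \<partial>M) (1/q) \<le> ennreal (16 * (1 + B)) * N"
      by (simp add: weighted_Lq_def)
  qed (use 2 in auto)
  also have "\<dots> = ennreal (16 * (1 + B) + 8 * B) * N"
  proof -
    have "ennreal (16 * (1 + B) + 8 * B) = ennreal (16 * (1 + B)) + ennreal (8 * B)"
      using B by (intro ennreal_plus) auto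
    then show ?thesis by (simp only: distrib_right)
  qed
  also have "16 * (1 + B) + 8 * B = 16 + 96 * 2 ^ (CARD('d) + 1)"
    by (simp add: B_def)
  finally show ?thesis by (simp add: N_def)
qed

end

theorem theorem3:
  fixes M :: "(real^'d) measure" and C0 n p q r :: real
  assumes "radon M" and "C0 > 0" and "0 < n" and "n \<le> real CARD('d)"
    and "growth M C0 n"
    and "1 \<le> q" and "q \<le> p" and "1 < r"
  shows "\<exists>C>0. \<forall>f :: nat \<Rightarrow> real^'d \<Rightarrow> real.
           (\<forall>j. f j \<in> Cpq M n p q) \<longrightarrow>
           (\<exists>I :: nat \<Rightarrow> 'd cube. (\<forall>k. doubling M (I k)) \<and> (\<forall>k. fst (I k) = fst (I 0))
               \<and> (\<forall>k. cube_set (I k) \<subseteq> cube_set (I (Suc k)))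
               \<and> (\<Union>k. cube_set (I k)) = UNIV
               \<and> (\<forall>j. (\<lambda>k. mean M (I k) (f j)) \<longlonglongrightarrow> 0)) \<longrightarrow>
           ennreal (1 / C) * Cpq_lr_norm M n p q r f \<le> Mpq_lr_norm M p q r f \<and>
           Mpq_lr_norm M p q r f \<le> ennreal C * Cpq_lr_norm M n p q r f"
proof -
  interpret growth_measure M C0 n
    using assms by unfold_locales
  \<comment> \<open>All constants are fixed before \<open>f\<close>: \<open>a\<close> depends on
    \<open>p\<close>, \<open>C0\<close> and \<open>n\<close>, and \<open>b\<close> on the
    dimension.\<close>
  define a b C where "a = 16 * (1 + 8 * Kqr_bound (8 powr p))" and "b = 16 + 96 * 2 ^ (CARD('d) + 1 :: nat)"
    and "C = max a b"
  have C: "a \<le> C" "b \<le> C" "0 < b" by (auto simp: C_def b_def add_pos_nonneg)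
  then have C_pos: "0 < C" by linarith
  show ?thesis
  proof (intro exI[of _ C] conjI allI impI C_pos)
    fix f :: "nat \<Rightarrow> real^'d \<Rightarrow> real"
    assume f: "\<forall>j. f j \<in> Cpq M n p q"
    let ?N = "Cpq_lr_norm M n p q r f" and ?M = "Mpq_lr_norm M p q r f"
    have "?N \<le> ennreal b * ?M"
      unfolding b_def using f assms by (intro Cpq_le_Mpq) auto
    also have "\<dots> \<le> ennreal C * ?M"
      using C by (intro mult_right_mono ennreal_leI) auto
    finally have "ennreal (1 / C) * ?N \<le> ennreal (1 / C) * (ennreal C * ?M)"
      by (intro mult_left_mono) auto
    also have "\<dots> = ?M"
      using C_pos by (simp add: mult.assoc[symmetric] flip: ennreal_mult)
    finally show "ennreal (1 / C) * ?N \<le> ?M" .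
    assume "\<exists>I :: nat \<Rightarrow> 'd cube. (\<forall>k. doubling M (I k)) \<and> (\<forall>k. fst (I k) = fst (I 0))
               \<and> (\<forall>k. cube_set (I k) \<subseteq> cube_set (I (Suc k)))
               \<and> (\<Union>k. cube_set (I k)) = UNIV
               \<and> (\<forall>j. (\<lambda>k. mean M (I k) (f j)) \<longlonglongrightarrow> 0)"
    then obtain I :: "nat \<Rightarrow> 'd cube" where I: "\<And>k. doubling M (I k)" "\<And>k. fst (I k) = fst (I 0)"
        "\<And>k. cube_set (I k) \<subseteq> cube_set (I (Suc k))" "(\<Union>k. cube_set (I k)) = UNIV"
        "\<And>j. (\<lambda>k. mean M (I k) (f j)) \<longlonglongrightarrow> 0"
      by blast
    have "?M \<le> ennreal a * ?N"
      unfolding a_def using f assms by (intro Mpq_le_Cpq[OF _ _ _ _ I]) auto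
    also have "\<dots> \<le> ennreal C * ?N"
      using C by (intro mult_right_mono ennreal_leI) auto
    finally show "?M \<le> ennreal C * ?N" .
  qed
qed

end
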